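(* Let $\mathcal{C}$ and $\mathcal{X}$ be categories with finite limits and finite colimits, and let $F:\mathcal{C}\to\mathcal{X}$ be a faithful essential localization. Suppose that (i) every pullback stable essential monomorphism in $\mathcal{X}$ is an isomorphism; (ii) dually, every pullback stable essential monomorphism in $\mathcal{X}^{\mathrm{op}}$ is an isomorphism; and (iii) $\mathcal{X}$ is balanced. Then the classes of pullback stable essential monomorphisms in $\mathcal{C}$ and in $\mathcal{C}^{\mathrm{op}}$ coincide with each other (as classes of morphisms of $\mathcal{C}$) and with the class of bimorphisms in $\mathcal{C}$. In particular, the dual $\mathcal{C}^{\mathrm{op}}\to\mathrm{Spec}(\mathcal{C})^{\mathrm{op}}$ of the canonical functor $\mathcal{C}\to\mathrm{Spec}(\mathcal{C})$ can be identified with the canonical functor $\mathcal{C}^{\mathrm{op}}\to\mathrm{Spec}(\mathcal{C}^{\mathrm{op}})$ (that is, there is an isomorphism of categories $\mathrm{Spec}(\mathcal{C})^{\mathrm{op}}\cong\mathrm{Spec}(\mathcal{C}^{\mathrm{op}})$ compatible with these functors from $\mathcal{C}^{\mathrm{op}}$), and there are equivalences of categories $$\mathrm{Spec}(\mathcal{C})\approx\mathcal{X}\approx\mathrm{Spec}(\mathcal{C}^{\mathrm{op}})^{\mathrm{op}}.$$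
   Context: A localization of $\mathcal{C}$ is an adjunction $(F,G,\eta,\varepsilon):\mathcal{C}\to\mathcal{X}$ ($F$ left adjoint to $G$, unit $\eta:1_{\mathcal{C}}\to GF$, counit $\varepsilon:FG\to 1_{\mathcal{X}}$) in which $F:\mathcal{C}\to\mathcal{X}$ preserves finite limits and $G:\mathcal{X}\to\mathcal{C}$ is fully faithful; one refers to it simply as $F$. It is faithful if the functor $F$ is faithful, and essential if $F$ also has a left adjoint. A monomorphism $m:S\to A$ in a category is an essential monomorphism if every morphism $f:A\to B$ for which $fm$ is a monomorphism is itself a monomorphism. It is a pullback stable essential monomorphism if, for every morphism $u:X\to A$, the pullback projection $S\times_A X\to X$ of $m$ along $u$ is an essential monomorphism. A bimorphism is a morphism that is both a monomorphism and an epimorphism; a category is balanced if every bimorphism in it is an isomorphism. For a category $\mathcal{A}$ with pullbacks, the spectral category $\mathrm{Spec}(\mathcal{A})$ is the category of fractions $\mathcal{A}[\Sigma^{-1}]$, where $\Sigma$ is the class of all pullback stable essential monomorphisms of $\mathcal{A}$; it comes with the canonical functor $\mathcal{A}\to\mathrm{Spec}(\mathcal{A})$, universal among functors out of $\mathcal{A}$ sending all elements of $\Sigma$ to isomorphisms. *)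

theory Defs
  imports Main
begin

section \<open>Categories, functors, natural transformations\<close>

record ('o, 'm) cat =
  Obj :: "'o set"
  Mor :: "'m set"
  Dom :: "'m \<Rightarrow> 'o"
  Cod :: "'m \<Rightarrow> 'o"
  Id :: "'o \<Rightarrow> 'm"
  Comp :: "'m \<Rightarrow> 'm \<Rightarrow> 'm" (infixl "\<cdot>\<index>" 70)

definition Hom :: "('o, 'm) cat \<Rightarrow> 'o \<Rightarrow> 'o \<Rightarrow> 'm set" where
  "Hom C a b = {f \<in> Mor C. Dom C f = a \<and> Cod C f = b}"

locale category =
  fixes C :: "('o, 'm) cat" (structure)
  assumes dom_obj: "f \<in> Mor C \<Longrightarrow> Dom C f \<in> Obj C"
    and cod_obj: "f \<in> Mor C \<Longrightarrow> Cod C f \<in> Obj C"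
    and id_hom: "a \<in> Obj C \<Longrightarrow> Id C a \<in> Hom C a a"
    and comp_hom: "\<lbrakk>f \<in> Hom C a b; g \<in> Hom C b c\<rbrakk> \<Longrightarrow> g \<cdot> f \<in> Hom C a c"
    and id_left: "f \<in> Hom C a b \<Longrightarrow> Id C b \<cdot> f = f"
    and id_right: "f \<in> Hom C a b \<Longrightarrow> f \<cdot> Id C a = f"
    and comp_assoc:
      "\<lbrakk>f \<in> Hom C a b; g \<in> Hom C b c; h \<in> Hom C c d\<rbrakk> \<Longrightarrow> h \<cdot> (g \<cdot> f) = (h \<cdot> g) \<cdot> f"

definition opp :: "('o, 'm) cat \<Rightarrow> ('o, 'm) cat" where
  "opp C = \<lparr>Obj = Obj C, Mor = Mor C, Dom = Cod C, Cod = Dom C, Id = Id C,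
            Comp = (\<lambda>g f. f \<cdot>\<^bsub>C\<^esub> g)\<rparr>"

record ('o, 'm, 'p, 'n) func =
  on_obj :: "'o \<Rightarrow> 'p"
  on_mor :: "'m \<Rightarrow> 'n"

definition is_functor ::
  "('o, 'm) cat \<Rightarrow> ('p, 'n) cat \<Rightarrow> ('o, 'm, 'p, 'n) func \<Rightarrow> bool" where
  "is_functor A B F \<longleftrightarrow>
     category A \<and> category B \<and>
     (\<forall>a\<in>Obj A. on_obj F a \<in> Obj B) \<and>
     (\<forall>a b. \<forall>f\<in>Hom A a b. on_mor F f \<in> Hom B (on_obj F a) (on_obj F b)) \<and>
     (\<forall>a\<in>Obj A. on_mor F (Id A a) = Id B (on_obj F a)) \<and>
     (\<forall>a b c. \<forall>f\<in>Hom A a b. \<forall>g\<in>Hom A b c.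
        on_mor F (g \<cdot>\<^bsub>A\<^esub> f) = on_mor F g \<cdot>\<^bsub>B\<^esub> on_mor F f)"

definition id_func :: "('o, 'm, 'o, 'm) func" where
  "id_func = \<lparr>on_obj = (\<lambda>a. a), on_mor = (\<lambda>f. f)\<rparr>"

definition comp_func ::
  "('p, 'n, 'q, 'k) func \<Rightarrow> ('o, 'm, 'p, 'n) func \<Rightarrow> ('o, 'm, 'q, 'k) func" where
  "comp_func G F =
     \<lparr>on_obj = (\<lambda>a. on_obj G (on_obj F a)), on_mor = (\<lambda>f. on_mor G (on_mor F f))\<rparr>"

definition opp_func :: "('o, 'm, 'p, 'n) func \<Rightarrow> ('o, 'm, 'p, 'n) func" where
  "opp_func F = \<lparr>on_obj = on_obj F, on_mor = on_mor F\<rparr>"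

text \<open>The maps underlying a functor are total functions, so functors are compared on the carriers
  of their source category only.\<close>

definition func_eq ::
  "('o, 'm) cat \<Rightarrow> ('o, 'm, 'p, 'n) func \<Rightarrow> ('o, 'm, 'p, 'n) func \<Rightarrow> bool" where
  "func_eq A F G \<longleftrightarrow>
     (\<forall>a\<in>Obj A. on_obj F a = on_obj G a) \<and> (\<forall>f\<in>Mor A. on_mor F f = on_mor G f)"

definition full :: "('o, 'm) cat \<Rightarrow> ('p, 'n) cat \<Rightarrow> ('o, 'm, 'p, 'n) func \<Rightarrow> bool" where
  "full A B F \<longleftrightarrow>
     (\<forall>a\<in>Obj A. \<forall>b\<in>Obj A. \<forall>g\<in>Hom B (on_obj F a) (on_obj F b).
        \<exists>f\<in>Hom A a b. on_mor F f = g)"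

definition faithful :: "('o, 'm) cat \<Rightarrow> ('o, 'm, 'p, 'n) func \<Rightarrow> bool" where
  "faithful A F \<longleftrightarrow>
     (\<forall>a\<in>Obj A. \<forall>b\<in>Obj A. \<forall>f\<in>Hom A a b. \<forall>g\<in>Hom A a b. on_mor F f = on_mor F g \<longrightarrow> f = g)"

definition is_iso :: "('o, 'm) cat \<Rightarrow> 'm \<Rightarrow> bool" where
  "is_iso C f \<longleftrightarrow> f \<in> Mor C \<and>
     (\<exists>g\<in>Hom C (Cod C f) (Dom C f).
        g \<cdot>\<^bsub>C\<^esub> f = Id C (Dom C f) \<and> f \<cdot>\<^bsub>C\<^esub> g = Id C (Cod C f))"

definition nat_trans ::
  "('o, 'm) cat \<Rightarrow> ('p, 'n) cat \<Rightarrow> ('o, 'm, 'p, 'n) func \<Rightarrow> ('o, 'm, 'p, 'n) func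
    \<Rightarrow> ('o \<Rightarrow> 'n) \<Rightarrow> bool" where
  "nat_trans A B F G \<tau> \<longleftrightarrow>
     is_functor A B F \<and> is_functor A B G \<and>
     (\<forall>a\<in>Obj A. \<tau> a \<in> Hom B (on_obj F a) (on_obj G a)) \<and>
     (\<forall>a b. \<forall>f\<in>Hom A a b. \<tau> b \<cdot>\<^bsub>B\<^esub> on_mor F f = on_mor G f \<cdot>\<^bsub>B\<^esub> \<tau> a)"

definition nat_iso ::
  "('o, 'm) cat \<Rightarrow> ('p, 'n) cat \<Rightarrow> ('o, 'm, 'p, 'n) func \<Rightarrow> ('o, 'm, 'p, 'n) func
    \<Rightarrow> ('o \<Rightarrow> 'n) \<Rightarrow> bool" where
  "nat_iso A B F G \<tau> \<longleftrightarrow> nat_trans A B F G \<tau> \<and> (\<forall>a\<in>Obj A. is_iso B (\<tau> a))"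

definition iso_of_categories ::
  "('o, 'm) cat \<Rightarrow> ('p, 'n) cat \<Rightarrow> ('o, 'm, 'p, 'n) func \<Rightarrow> bool" where
  "iso_of_categories A B \<Phi> \<longleftrightarrow>
     is_functor A B \<Phi> \<and>
     (\<exists>\<Psi>. is_functor B A \<Psi> \<and>
        func_eq A (comp_func \<Psi> \<Phi>) id_func \<and> func_eq B (comp_func \<Phi> \<Psi>) id_func)"

definition equivalent_categories :: "('o, 'm) cat \<Rightarrow> ('p, 'n) cat \<Rightarrow> bool" where
  "equivalent_categories A B \<longleftrightarrow>
     (\<exists>(K :: ('o, 'm, 'p, 'n) func) (L :: ('p, 'n, 'o, 'm) func) \<alpha> \<beta>.
        is_functor A B K \<and> is_functor B A L \<and>
        nat_iso A A id_func (comp_func L K) \<alpha> \<and> nat_iso B B (comp_func K L) id_func \<beta>)"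

section \<open>Finite limits and colimits\<close>

definition is_cone ::
  "('i, 'j) cat \<Rightarrow> ('o, 'm) cat \<Rightarrow> ('i, 'j, 'o, 'm) func \<Rightarrow> 'o \<Rightarrow> ('i \<Rightarrow> 'm) \<Rightarrow> bool" where
  "is_cone J C D l p \<longleftrightarrow>
     l \<in> Obj C \<and> (\<forall>i\<in>Obj J. p i \<in> Hom C l (on_obj D i)) \<and>
     (\<forall>i j. \<forall>u\<in>Hom J i j. on_mor D u \<cdot>\<^bsub>C\<^esub> p i = p j)"

definition is_limit ::
  "('i, 'j) cat \<Rightarrow> ('o, 'm) cat \<Rightarrow> ('i, 'j, 'o, 'm) func \<Rightarrow> 'o \<Rightarrow> ('i \<Rightarrow> 'm) \<Rightarrow> bool" where
  "is_limit J C D l p \<longleftrightarrow>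
     is_cone J C D l p \<and>
     (\<forall>k q. is_cone J C D k q \<longrightarrow>
        (\<exists>!h. h \<in> Hom C k l \<and> (\<forall>i\<in>Obj J. p i \<cdot>\<^bsub>C\<^esub> h = q i)))"

text \<open>Every finite category is isomorphic to one whose objects and morphisms are natural numbers, so
  nothing is lost by taking the shapes of finite diagrams to be of this kind.\<close>

definition finite_diagram ::
  "(nat, nat) cat \<Rightarrow> ('o, 'm) cat \<Rightarrow> (nat, nat, 'o, 'm) func \<Rightarrow> bool" where
  "finite_diagram J C D \<longleftrightarrow> finite (Obj J) \<and> finite (Mor J) \<and> is_functor J C D"

definition has_finite_limits :: "('o, 'm) cat \<Rightarrow> bool" where
  "has_finite_limits C \<longleftrightarrow> (\<forall>J D. finite_diagram J C D \<longrightarrow> (\<exists>l p. is_limit J C D l p))"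

definition has_finite_colimits :: "('o, 'm) cat \<Rightarrow> bool" where
  "has_finite_colimits C \<longleftrightarrow> has_finite_limits (opp C)"

definition preserves_finite_limits ::
  "('o, 'm) cat \<Rightarrow> ('p, 'n) cat \<Rightarrow> ('o, 'm, 'p, 'n) func \<Rightarrow> bool" where
  "preserves_finite_limits C X F \<longleftrightarrow>
     (\<forall>J D l p. finite_diagram J C D \<and> is_limit J C D l p \<longrightarrow>
        is_limit J X (comp_func F D) (on_obj F l) (\<lambda>i. on_mor F (p i)))"

section \<open>Localizations\<close>

definition adjunction ::
  "('o, 'm) cat \<Rightarrow> ('p, 'n) cat \<Rightarrow> ('o, 'm, 'p, 'n) func \<Rightarrow> ('p, 'n, 'o, 'm) func
    \<Rightarrow> ('o \<Rightarrow> 'm) \<Rightarrow> ('p \<Rightarrow> 'n) \<Rightarrow> bool" where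
  "adjunction C X F G \<eta> \<epsilon> \<longleftrightarrow>
     is_functor C X F \<and> is_functor X C G \<and>
     nat_trans C C id_func (comp_func G F) \<eta> \<and>
     nat_trans X X (comp_func F G) id_func \<epsilon> \<and>
     (\<forall>c\<in>Obj C. \<epsilon> (on_obj F c) \<cdot>\<^bsub>X\<^esub> on_mor F (\<eta> c) = Id X (on_obj F c)) \<and>
     (\<forall>x\<in>Obj X. on_mor G (\<epsilon> x) \<cdot>\<^bsub>C\<^esub> \<eta> (on_obj G x) = Id C (on_obj G x))"

definition localization ::
  "('o, 'm) cat \<Rightarrow> ('p, 'n) cat \<Rightarrow> ('o, 'm, 'p, 'n) func \<Rightarrow> ('p, 'n, 'o, 'm) func
    \<Rightarrow> ('o \<Rightarrow> 'm) \<Rightarrow> ('p \<Rightarrow> 'n) \<Rightarrow> bool" where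
  "localization C X F G \<eta> \<epsilon> \<longleftrightarrow>
     adjunction C X F G \<eta> \<epsilon> \<and> preserves_finite_limits C X F \<and> full X C G \<and> faithful X G"

definition has_left_adjoint ::
  "('o, 'm) cat \<Rightarrow> ('p, 'n) cat \<Rightarrow> ('o, 'm, 'p, 'n) func \<Rightarrow> bool" where
  "has_left_adjoint C X F \<longleftrightarrow> (\<exists>H \<eta> \<epsilon>. adjunction X C H F \<eta> \<epsilon>)"

definition essential_localization ::
  "('o, 'm) cat \<Rightarrow> ('p, 'n) cat \<Rightarrow> ('o, 'm, 'p, 'n) func \<Rightarrow> ('p, 'n, 'o, 'm) func
    \<Rightarrow> ('o \<Rightarrow> 'm) \<Rightarrow> ('p \<Rightarrow> 'n) \<Rightarrow> bool" where
  "essential_localization C X F G \<eta> \<epsilon> \<longleftrightarrow>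
     localization C X F G \<eta> \<epsilon> \<and> has_left_adjoint C X F"

section \<open>Monomorphisms\<close>

definition is_mono :: "('o, 'm) cat \<Rightarrow> 'm \<Rightarrow> bool" where
  "is_mono C m \<longleftrightarrow> m \<in> Mor C \<and>
     (\<forall>a. \<forall>g\<in>Hom C a (Dom C m). \<forall>h\<in>Hom C a (Dom C m). m \<cdot>\<^bsub>C\<^esub> g = m \<cdot>\<^bsub>C\<^esub> h \<longrightarrow> g = h)"

definition is_epi :: "('o, 'm) cat \<Rightarrow> 'm \<Rightarrow> bool" where
  "is_epi C m \<longleftrightarrow> m \<in> Mor C \<and>
     (\<forall>b. \<forall>g\<in>Hom C (Cod C m) b. \<forall>h\<in>Hom C (Cod C m) b. g \<cdot>\<^bsub>C\<^esub> m = h \<cdot>\<^bsub>C\<^esub> m \<longrightarrow> g = h)"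

definition bimorphism :: "('o, 'm) cat \<Rightarrow> 'm \<Rightarrow> bool" where
  "bimorphism C m \<longleftrightarrow> is_mono C m \<and> is_epi C m"

definition balanced :: "('o, 'm) cat \<Rightarrow> bool" where
  "balanced C \<longleftrightarrow> (\<forall>m. bimorphism C m \<longrightarrow> is_iso C m)"

definition essential_mono :: "('o, 'm) cat \<Rightarrow> 'm \<Rightarrow> bool" where
  "essential_mono C m \<longleftrightarrow> is_mono C m \<and>
     (\<forall>b. \<forall>f\<in>Hom C (Cod C m) b. is_mono C (f \<cdot>\<^bsub>C\<^esub> m) \<longrightarrow> is_mono C f)"

text \<open>In \<open>is_pullback C f g p q\<close>, the morphism \<open>q\<close> is the pullback of \<open>f\<close> along \<open>g\<close>.\<close>

definition is_pullback :: "('o, 'm) cat \<Rightarrow> 'm \<Rightarrow> 'm \<Rightarrow> 'm \<Rightarrow> 'm \<Rightarrow> bool" where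
  "is_pullback C f g p q \<longleftrightarrow>
     f \<in> Mor C \<and> g \<in> Mor C \<and> p \<in> Mor C \<and> q \<in> Mor C \<and>
     Cod C f = Cod C g \<and> Dom C p = Dom C q \<and> Cod C p = Dom C f \<and> Cod C q = Dom C g \<and>
     f \<cdot>\<^bsub>C\<^esub> p = g \<cdot>\<^bsub>C\<^esub> q \<and>
     (\<forall>t. \<forall>x\<in>Hom C t (Dom C f). \<forall>y\<in>Hom C t (Dom C g).
        f \<cdot>\<^bsub>C\<^esub> x = g \<cdot>\<^bsub>C\<^esub> y \<longrightarrow>
        (\<exists>!h. h \<in> Hom C t (Dom C p) \<and> p \<cdot>\<^bsub>C\<^esub> h = x \<and> q \<cdot>\<^bsub>C\<^esub> h = y))"

text \<open>Pullbacks are determined only up to isomorphism; the condition is imposed on every choice of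
  pullback. The notion is meant for categories with pullbacks.\<close>

definition pullback_stable_essential_mono :: "('o, 'm) cat \<Rightarrow> 'm \<Rightarrow> bool" where
  "pullback_stable_essential_mono C m \<longleftrightarrow>
     is_mono C m \<and> (\<forall>u p q. is_pullback C m u p q \<longrightarrow> essential_mono C q)"

section \<open>Categories of fractions\<close>

text \<open>The category of fractions \<open>C[S\<inverse>]\<close> is the Gabriel--Zisman construction. It has the objects of
  \<open>C\<close>; its morphisms are classes of zigzags, that is, of composable lists (read in the order in
  which the steps are travelled) of morphisms of \<open>C\<close> and of formal inverses of elements of \<open>S\<close>,
  modulo the least congruence making \<open>C \<rightarrow> C[S\<inverse>]\<close> a functor and the formal inverses inverses.
  Its universal property is \<open>fractions_universal\<close> below.\<close>

datatype 'm step = Fwd 'm | Bwd 'm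

fun zigzag :: "('o, 'm) cat \<Rightarrow> 'm set \<Rightarrow> 'o \<Rightarrow> 'm step list \<Rightarrow> 'o \<Rightarrow> bool" where
  "zigzag C S a [] b \<longleftrightarrow> a \<in> Obj C \<and> a = b"
| "zigzag C S a (Fwd f # p) b \<longleftrightarrow> f \<in> Mor C \<and> Dom C f = a \<and> zigzag C S (Cod C f) p b"
| "zigzag C S a (Bwd s # p) b \<longleftrightarrow>
     s \<in> S \<and> s \<in> Mor C \<and> Cod C s = a \<and> zigzag C S (Dom C s) p b"

inductive zigzag_eq ::
  "('o, 'm) cat \<Rightarrow> 'm set \<Rightarrow> 'o \<Rightarrow> 'o \<Rightarrow> 'm step list \<Rightarrow> 'm step list \<Rightarrow> bool"
  for C S where
  zz_refl: "zigzag C S a p b \<Longrightarrow> zigzag_eq C S a b p p"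
| zz_sym: "zigzag_eq C S a b p q \<Longrightarrow> zigzag_eq C S a b q p"
| zz_trans: "\<lbrakk>zigzag_eq C S a b p q; zigzag_eq C S a b q r\<rbrakk> \<Longrightarrow> zigzag_eq C S a b p r"
| zz_append: "\<lbrakk>zigzag_eq C S a b p p'; zigzag_eq C S b c q q'\<rbrakk>
    \<Longrightarrow> zigzag_eq C S a c (p @ q) (p' @ q')"
| zz_id: "a \<in> Obj C \<Longrightarrow> zigzag_eq C S a a [Fwd (Id C a)] []"
| zz_comp: "\<lbrakk>f \<in> Hom C a b; g \<in> Hom C b c\<rbrakk>
    \<Longrightarrow> zigzag_eq C S a c [Fwd f, Fwd g] [Fwd (g \<cdot>\<^bsub>C\<^esub> f)]"
| zz_fwd_bwd: "\<lbrakk>s \<in> S; s \<in> Hom C a b\<rbrakk> \<Longrightarrow> zigzag_eq C S a a [Fwd s, Bwd s] []"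
| zz_bwd_fwd: "\<lbrakk>s \<in> S; s \<in> Hom C a b\<rbrakk> \<Longrightarrow> zigzag_eq C S b b [Bwd s, Fwd s] []"

type_synonym ('o, 'm) fraction = "'o \<times> 'm step list set \<times> 'o"

definition frac ::
  "('o, 'm) cat \<Rightarrow> 'm set \<Rightarrow> 'o \<Rightarrow> 'm step list \<Rightarrow> 'o \<Rightarrow> ('o, 'm) fraction" where
  "frac C S a p b = (a, {q. zigzag_eq C S a b p q}, b)"

definition fractions :: "('o, 'm) cat \<Rightarrow> 'm set \<Rightarrow> ('o, ('o, 'm) fraction) cat" where
  "fractions C S =
     \<lparr>Obj = Obj C,
      Mor = {frac C S a p b | a p b. zigzag C S a p b},
      Dom = (\<lambda>(a, P, b). a),
      Cod = (\<lambda>(a, P, b). b),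
      Id = (\<lambda>a. frac C S a [] a),
      Comp = (\<lambda>(b', Q, c) (a, P, b). (a, {r. \<exists>p\<in>P. \<exists>q\<in>Q. zigzag_eq C S a c (p @ q) r}, c))\<rparr>"

definition to_fractions ::
  "('o, 'm) cat \<Rightarrow> 'm set \<Rightarrow> ('o, 'm, 'o, ('o, 'm) fraction) func" where
  "to_fractions C S =
     \<lparr>on_obj = (\<lambda>a. a), on_mor = (\<lambda>f. frac C S (Dom C f) [Fwd f] (Cod C f))\<rparr>"

definition Spec :: "('o, 'm) cat \<Rightarrow> ('o, ('o, 'm) fraction) cat" where
  "Spec C = fractions C {m. pullback_stable_essential_mono C m}"

definition to_Spec :: "('o, 'm) cat \<Rightarrow> ('o, 'm, 'o, ('o, 'm) fraction) func" where
  "to_Spec C = to_fractions C {m. pullback_stable_essential_mono C m}"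

subsection \<open>Basic properties\<close>

lemma Hom_morI: "f \<in> Mor C \<Longrightarrow> f \<in> Hom C (Dom C f) (Cod C f)"
  by (simp add: Hom_def)

lemma Hom_opp: "Hom (opp C) a b = Hom C b a"
  by (auto simp: Hom_def opp_def)

lemma opp_simps [simp]:
  "Obj (opp C) = Obj C" "Mor (opp C) = Mor C" "Dom (opp C) = Cod C" "Cod (opp C) = Dom C"
  "Id (opp C) = Id C" "g \<cdot>\<^bsub>opp C\<^esub> f = f \<cdot>\<^bsub>C\<^esub> g"
  by (simp_all add: opp_def)

lemma category_opp:
  assumes "category C"
  shows "category (opp C)"
proof -
  interpret category C by fact
  show ?thesis
    by unfold_locales
      (simp_all add: Hom_opp dom_obj cod_obj id_hom comp_hom id_left id_right comp_assoc[symmetric])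
qed

lemma opp_opp: "opp (opp C) = C"
  by (simp add: opp_def)

lemma is_functor_opp: "is_functor A B F \<Longrightarrow> is_functor (opp A) (opp B) (opp_func F)"
  unfolding is_functor_def opp_func_def Hom_opp by (simp add: category_opp)

lemma zigzag_append:
  "zigzag C S a p b \<Longrightarrow> zigzag C S b q c \<Longrightarrow> zigzag C S a (p @ q) c"
  by (induction C S a p b rule: zigzag.induct) auto

lemma zigzag_ends:
  assumes "category C" "zigzag C S a p b"
  shows "a \<in> Obj C \<and> b \<in> Obj C"
  using assms(2,1)
  by (induction C S a p b rule: zigzag.induct) (auto simp: category.dom_obj category.cod_obj)

lemma zigzag_eq_zigzag:
  assumes "category C" "zigzag_eq C S a b p q"
  shows "zigzag C S a p b \<and> zigzag C S a q b"
  using assms(2)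
proof induction
  case (zz_append a b p p' c q q')
  then show ?case by (blast intro: zigzag_append)
next
  case (zz_id a)
  then show ?case using category.id_hom[OF assms(1), of a] by (simp add: Hom_def)
next
  case (zz_comp f a b g c)
  then show ?case
    using category.comp_hom[OF assms(1) zz_comp] category.cod_obj[OF assms(1)]
    by (auto simp: Hom_def)
next
  case (zz_fwd_bwd s a b)
  then show ?case
    using category.dom_obj[OF assms(1), of s] by (auto simp: Hom_def)
next
  case (zz_bwd_fwd s a b)
  then show ?case
    using category.cod_obj[OF assms(1), of s] by (auto simp: Hom_def)
qed auto

lemma frac_eq_iff:
  assumes "zigzag C S a q b"
  shows "frac C S a p b = frac C S a q b \<longleftrightarrow> zigzag_eq C S a b p q"
  unfolding frac_def using zz_refl[OF assms] by (auto intro: zz_sym zz_trans)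

lemma frac_comp:
  assumes "zigzag C S a p b" "zigzag C S b q c"
  shows "frac C S b q c \<cdot>\<^bsub>fractions C S\<^esub> frac C S a p b = frac C S a (p @ q) c"
proof -
  have "(\<exists>p'. zigzag_eq C S a b p p' \<and> (\<exists>q'. zigzag_eq C S b c q q' \<and> zigzag_eq C S a c (p' @ q') r))
      \<longleftrightarrow> zigzag_eq C S a c (p @ q) r" for r
  proof
    assume "\<exists>p'. zigzag_eq C S a b p p' \<and> (\<exists>q'. zigzag_eq C S b c q q' \<and> zigzag_eq C S a c (p' @ q') r)"
    then obtain p' q' where "zigzag_eq C S a b p p'" "zigzag_eq C S b c q q'"
      and r: "zigzag_eq C S a c (p' @ q') r" by blast
    then have "zigzag_eq C S a c (p @ q) (p' @ q')" by (blast intro: zz_append)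
    then show "zigzag_eq C S a c (p @ q) r" using r by (rule zz_trans)
  next
    assume "zigzag_eq C S a c (p @ q) r"
    then show "\<exists>p'. zigzag_eq C S a b p p' \<and> (\<exists>q'. zigzag_eq C S b c q q' \<and> zigzag_eq C S a c (p' @ q') r)"
      using zz_refl[OF assms(1)] zz_refl[OF assms(2)] by blast
  qed
  then show ?thesis by (simp add: frac_def fractions_def Bex_def)
qed

lemma Hom_fractions:
  "x \<in> Hom (fractions C S) a b \<longleftrightarrow> (\<exists>p. zigzag C S a p b \<and> x = frac C S a p b)"
  by (auto simp: Hom_def fractions_def frac_def)

lemma frac_hom: "zigzag C S a p b \<Longrightarrow> frac C S a p b \<in> Hom (fractions C S) a b"
  unfolding Hom_fractions by (rule exI[of _ p]) simp

lemma fractions_simps: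
  "Obj (fractions C S) = Obj C"
  "Id (fractions C S) a = frac C S a [] a"
  "Dom (fractions C S) (frac C S a p b) = a"
  "Cod (fractions C S) (frac C S a p b) = b"
  by (simp_all add: fractions_def frac_def)

lemma category_fractions:
  assumes C: "category C"
  shows "category (fractions C S)"
proof
  fix f assume "f \<in> Mor (fractions C S)"
  then obtain a p b where "zigzag C S a p b" "f = frac C S a p b"
    by (auto simp: fractions_def)
  then show "Dom (fractions C S) f \<in> Obj (fractions C S)"
    and "Cod (fractions C S) f \<in> Obj (fractions C S)"
    using zigzag_ends[OF C] by (simp_all add: fractions_simps)
next
  fix a assume "a \<in> Obj (fractions C S)"
  then show "Id (fractions C S) a \<in> Hom (fractions C S) a a"
    by (auto simp: fractions_simps Hom_fractions intro!: exI[of _ "[]"])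
next
  fix f g a b c assume "f \<in> Hom (fractions C S) a b" "g \<in> Hom (fractions C S) b c"
  then show "g \<cdot>\<^bsub>fractions C S\<^esub> f \<in> Hom (fractions C S) a c"
    by (auto simp: Hom_fractions frac_comp intro: zigzag_append)
next
  fix f a b assume "f \<in> Hom (fractions C S) a b"
  then obtain p where p: "zigzag C S a p b" and f: "f = frac C S a p b"
    by (auto simp: Hom_fractions)
  have "zigzag C S a [] a" "zigzag C S b [] b" using zigzag_ends[OF C p] by simp_all
  then show "Id (fractions C S) b \<cdot>\<^bsub>fractions C S\<^esub> f = f"
    and "f \<cdot>\<^bsub>fractions C S\<^esub> Id (fractions C S) a = f"
    using p by (simp_all add: f fractions_simps frac_comp)
next
  fix f g h a b c d
  assume "f \<in> Hom (fractions C S) a b" "g \<in> Hom (fractions C S) b c"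
    "h \<in> Hom (fractions C S) c d"
  then obtain p q r where p: "zigzag C S a p b" and q: "zigzag C S b q c" and r: "zigzag C S c r d"
    and fgh: "f = frac C S a p b" "g = frac C S b q c" "h = frac C S c r d"
    by (auto simp: Hom_fractions)
  show "h \<cdot>\<^bsub>fractions C S\<^esub> (g \<cdot>\<^bsub>fractions C S\<^esub> f)
      = h \<cdot>\<^bsub>fractions C S\<^esub> g \<cdot>\<^bsub>fractions C S\<^esub> f"
    by (simp add: fgh frac_comp[OF p q] frac_comp[OF q r] frac_comp[OF zigzag_append[OF p q] r]
        frac_comp[OF p zigzag_append[OF q r]])
qed

lemma zigzag_Fwd:
  assumes "category C" "f \<in> Hom C a b"
  shows "zigzag C S a [Fwd f] b"
  using assms category.cod_obj[OF assms(1), of f] by (auto simp: Hom_def)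

lemma zigzag_Bwd:
  assumes "category C" "s \<in> S" "s \<in> Hom C a b"
  shows "zigzag C S b [Bwd s] a"
  using assms category.dom_obj[OF assms(1), of s] by (auto simp: Hom_def)

lemma on_mor_to_fractions:
  "f \<in> Hom C a b \<Longrightarrow> on_mor (to_fractions C S) f = frac C S a [Fwd f] b"
  by (auto simp: to_fractions_def Hom_def)

lemma is_functor_to_fractions:
  assumes C: "category C"
  shows "is_functor C (fractions C S) (to_fractions C S)"
  unfolding is_functor_def
proof (intro conjI ballI allI)
  show "category C" "category (fractions C S)" using C category_fractions[OF C] by auto
  fix a assume a: "a \<in> Obj C"
  show "on_obj (to_fractions C S) a \<in> Obj (fractions C S)"
    using a by (simp add: to_fractions_def fractions_simps)
  have "zigzag C S a [] a" using a by simp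
  then have "frac C S a [Fwd (Id C a)] a = frac C S a [] a"
    by (rule iffD2[OF frac_eq_iff]) (rule zz_id[OF a])
  then show "on_mor (to_fractions C S) (Id C a) = Id (fractions C S) (on_obj (to_fractions C S) a)"
    unfolding on_mor_to_fractions[OF category.id_hom[OF C a]] fractions_simps
    by (simp add: to_fractions_def)
next
  fix a b f assume f: "f \<in> Hom C a b"
  show "on_mor (to_fractions C S) f
      \<in> Hom (fractions C S) (on_obj (to_fractions C S) a) (on_obj (to_fractions C S) b)"
    using frac_hom[OF zigzag_Fwd[where S = S, OF C f]] unfolding on_mor_to_fractions[OF f]
    by (simp add: to_fractions_def)
next
  fix a b c f g assume f: "f \<in> Hom C a b" and g: "g \<in> Hom C b c"
  note gf = category.comp_hom[OF C f g]
  have "frac C S a [Fwd f, Fwd g] c = frac C S a [Fwd (g \<cdot>\<^bsub>C\<^esub> f)] c"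
    by (rule iffD2[OF frac_eq_iff[OF zigzag_Fwd[OF C gf]] zz_comp[OF f g]])
  moreover note frac_comp[OF zigzag_Fwd[where S = S, OF C f] zigzag_Fwd[where S = S, OF C g]]
  ultimately show "on_mor (to_fractions C S) (g \<cdot>\<^bsub>C\<^esub> f)
      = on_mor (to_fractions C S) g \<cdot>\<^bsub>fractions C S\<^esub> on_mor (to_fractions C S) f"
    by (simp add: on_mor_to_fractions[OF f] on_mor_to_fractions[OF g] on_mor_to_fractions[OF gf])
qed

lemma to_fractions_inverts:
  assumes C: "category C" and s: "s \<in> S" "s \<in> Mor C"
  shows "is_iso (fractions C S) (on_mor (to_fractions C S) s)"
proof -
  obtain a b where h: "s \<in> Hom C a b" using s by (auto simp: Hom_def)
  note F = zigzag_Fwd[OF C h, of S] and B = zigzag_Bwd[where S = S, OF C s(1) h]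
  have ab: "zigzag C S a [] a" "zigzag C S b [] b" using zigzag_ends[OF C F] by auto
  have "frac C S b [Bwd s] a \<cdot>\<^bsub>fractions C S\<^esub> frac C S a [Fwd s] b = frac C S a [] a"
    using frac_comp[OF F B] iffD2[OF frac_eq_iff[OF ab(1)] zz_fwd_bwd[OF s(1) h]] by simp
  moreover have "frac C S a [Fwd s] b \<cdot>\<^bsub>fractions C S\<^esub> frac C S b [Bwd s] a = frac C S b [] b"
    using frac_comp[OF B F] iffD2[OF frac_eq_iff[OF ab(2)] zz_bwd_fwd[OF s(1) h]] by simp
  moreover have "frac C S a [Fwd s] b \<in> Mor (fractions C S)"
    using frac_hom[OF F] by (simp add: Hom_def)
  moreover have "frac C S b [Bwd s] a \<in> Hom (fractions C S) b a"
    by (rule frac_hom[OF B])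
  ultimately show ?thesis
    unfolding is_iso_def on_mor_to_fractions[OF h] fractions_simps by blast
qed

text \<open>The value of a functor \<open>T : C \<rightarrow> B\<close> on a zigzag whose backward steps it inverts.\<close>

definition inv_mor :: "('o, 'm) cat \<Rightarrow> 'm \<Rightarrow> 'm" where
  "inv_mor C f = (SOME g. g \<in> Hom C (Cod C f) (Dom C f) \<and>
     g \<cdot>\<^bsub>C\<^esub> f = Id C (Dom C f) \<and> f \<cdot>\<^bsub>C\<^esub> g = Id C (Cod C f))"

fun zigzag_val ::
  "('o, 'm) cat \<Rightarrow> ('p, 'n) cat \<Rightarrow> ('o, 'm, 'p, 'n) func \<Rightarrow> 'o \<Rightarrow> 'm step list \<Rightarrow> 'n" where
  "zigzag_val C B T a [] = Id B (on_obj T a)"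
| "zigzag_val C B T a (Fwd f # p) = zigzag_val C B T (Cod C f) p \<cdot>\<^bsub>B\<^esub> on_mor T f"
| "zigzag_val C B T a (Bwd s # p) = zigzag_val C B T (Dom C s) p \<cdot>\<^bsub>B\<^esub> inv_mor B (on_mor T s)"

lemma inv_mor:
  assumes "is_iso C f" "f \<in> Hom C a b"
  shows "inv_mor C f \<in> Hom C b a" "inv_mor C f \<cdot>\<^bsub>C\<^esub> f = Id C a" "f \<cdot>\<^bsub>C\<^esub> inv_mor C f = Id C b"
proof -
  have "\<exists>g. g \<in> Hom C (Cod C f) (Dom C f) \<and>
     g \<cdot>\<^bsub>C\<^esub> f = Id C (Dom C f) \<and> f \<cdot>\<^bsub>C\<^esub> g = Id C (Cod C f)"
    using assms(1) by (auto simp: is_iso_def)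
  from someI_ex[OF this, folded inv_mor_def]
  show "inv_mor C f \<in> Hom C b a" "inv_mor C f \<cdot>\<^bsub>C\<^esub> f = Id C a" "f \<cdot>\<^bsub>C\<^esub> inv_mor C f = Id C b"
    using assms(2) by (auto simp: Hom_def)
qed

lemma inv_mor_unique:
  assumes C: "category C" and f: "f \<in> Hom C a b" and g: "g \<in> Hom C b a"
    and gf: "g \<cdot>\<^bsub>C\<^esub> f = Id C a" and fg: "f \<cdot>\<^bsub>C\<^esub> g = Id C b"
  shows "g = inv_mor C f"
proof -
  have "is_iso C f" using f g gf fg by (auto simp: is_iso_def Hom_def)
  note i = inv_mor[OF this f]
  have "g = (inv_mor C f \<cdot>\<^bsub>C\<^esub> f) \<cdot>\<^bsub>C\<^esub> g" using i(2) category.id_left[OF C g] by simp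
  also have "\<dots> = inv_mor C f \<cdot>\<^bsub>C\<^esub> (f \<cdot>\<^bsub>C\<^esub> g)"
    using category.comp_assoc[OF C g f i(1)] by simp
  finally show ?thesis using fg category.id_right[OF C i(1)] by simp
qed

context
  fixes C :: "('o, 'm) cat" and B :: "('p, 'n) cat" and S T
  assumes T: "is_functor C B T" and inv: "\<And>s. \<lbrakk>s \<in> S; s \<in> Mor C\<rbrakk> \<Longrightarrow> is_iso B (on_mor T s)"
begin

private lemma C: "category C" and B: "category B"
  using T by (auto simp: is_functor_def)

private lemma T_obj: "a \<in> Obj C \<Longrightarrow> on_obj T a \<in> Obj B"
  and T_hom: "f \<in> Hom C a b \<Longrightarrow> on_mor T f \<in> Hom B (on_obj T a) (on_obj T b)"
  and T_id: "a \<in> Obj C \<Longrightarrow> on_mor T (Id C a) = Id B (on_obj T a)"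
  and T_comp: "\<lbrakk>f \<in> Hom C a b; g \<in> Hom C b c\<rbrakk>
    \<Longrightarrow> on_mor T (g \<cdot>\<^bsub>C\<^esub> f) = on_mor T g \<cdot>\<^bsub>B\<^esub> on_mor T f"
  using T unfolding is_functor_def by blast+

private lemma T_inv:
  assumes "s \<in> S" "s \<in> Hom C a b"
  shows "inv_mor B (on_mor T s) \<in> Hom B (on_obj T b) (on_obj T a)"
    "inv_mor B (on_mor T s) \<cdot>\<^bsub>B\<^esub> on_mor T s = Id B (on_obj T a)"
    "on_mor T s \<cdot>\<^bsub>B\<^esub> inv_mor B (on_mor T s) = Id B (on_obj T b)"
  using inv_mor[OF inv T_hom[OF assms(2)]] assms by (auto simp: Hom_def)

lemma zigzag_val_hom:
  "zigzag C S a p b \<Longrightarrow> zigzag_val C B T a p \<in> Hom B (on_obj T a) (on_obj T b)"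
proof (induction p arbitrary: a)
  case Nil
  then show ?case using category.id_hom[OF B] T_obj by auto
next
  case (Cons x p)
  show ?case
  proof (cases x)
    case (Fwd f)
    then show ?thesis using Cons category.comp_hom[OF B T_hom[OF Hom_morI[of f]]] by auto
  next
    case (Bwd s)
    then show ?thesis
      using Cons category.comp_hom[OF B T_inv(1)[OF _ Hom_morI[of s]]] by auto
  qed
qed

lemma zigzag_val_append:
  assumes q: "zigzag C S b q c"
  shows "zigzag C S a p b \<Longrightarrow>
    zigzag_val C B T a (p @ q) = zigzag_val C B T b q \<cdot>\<^bsub>B\<^esub> zigzag_val C B T a p"
proof (induction p arbitrary: a)
  case Nil
  then show ?case using category.id_right[OF B zigzag_val_hom[OF q]] by simp
next
  case (Cons x p)
  note qv = zigzag_val_hom[OF q]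
  show ?case
  proof (cases x)
    case (Fwd f)
    with Cons have p: "zigzag C S (Cod C f) p b" and f: "f \<in> Mor C" "Dom C f = a" by auto
    show ?thesis
      using Fwd Cons.IH[OF p] category.comp_assoc[OF B T_hom[OF Hom_morI[OF f(1)]] zigzag_val_hom[OF p] qv]
      by simp
  next
    case (Bwd s)
    with Cons have p: "zigzag C S (Dom C s) p b" and s: "s \<in> S" "s \<in> Mor C" "Cod C s = a" by auto
    show ?thesis
      using Bwd Cons.IH[OF p]
        category.comp_assoc[OF B T_inv(1)[OF s(1) Hom_morI[OF s(2)]] zigzag_val_hom[OF p] qv]
      by simp
  qed
qed

lemma zigzag_val_Fwd:
  assumes "f \<in> Hom C a b"
  shows "zigzag_val C B T a [Fwd f] = on_mor T f"
  using assms category.id_left[OF B T_hom[OF assms]] by (auto simp: Hom_def)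

lemma zigzag_val_Bwd:
  assumes "s \<in> S" "s \<in> Hom C a b"
  shows "zigzag_val C B T b [Bwd s] = inv_mor B (on_mor T s)"
  using assms category.id_left[OF B T_inv(1)[OF assms]] by (auto simp: Hom_def)

lemma zigzag_val_eq: "zigzag_eq C S a b p q \<Longrightarrow> zigzag_val C B T a p = zigzag_val C B T a q"
proof (induction rule: zigzag_eq.induct)
  case (zz_append a b p p' c q q')
  have z: "zigzag C S a p b" "zigzag C S a p' b" "zigzag C S b q c" "zigzag C S b q' c"
    using zigzag_eq_zigzag[OF C] zz_append by blast+
  show ?case
    using zz_append.IH zigzag_val_append[OF z(3,1)] zigzag_val_append[OF z(4,2)] by simp
next
  case (zz_id a)
  then show ?case using zigzag_val_Fwd[OF category.id_hom[OF C zz_id]] T_id by simp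
next
  case (zz_comp f a b g c)
  have "zigzag_val C B T a ([Fwd f] @ [Fwd g]) = on_mor T g \<cdot>\<^bsub>B\<^esub> on_mor T f"
    by (simp only: zigzag_val_append[OF zigzag_Fwd[OF C zz_comp(2)] zigzag_Fwd[OF C zz_comp(1)]]
        zigzag_val_Fwd[OF zz_comp(1)] zigzag_val_Fwd[OF zz_comp(2)])
  then show ?case
    using zigzag_val_Fwd[OF category.comp_hom[OF C zz_comp]] T_comp[OF zz_comp] by simp
next
  case (zz_fwd_bwd s a b)
  have "zigzag_val C B T a ([Fwd s] @ [Bwd s]) = inv_mor B (on_mor T s) \<cdot>\<^bsub>B\<^esub> on_mor T s"
    by (simp only: zigzag_val_append[OF zigzag_Bwd[OF C zz_fwd_bwd] zigzag_Fwd[OF C zz_fwd_bwd(2)]]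
        zigzag_val_Fwd[OF zz_fwd_bwd(2)] zigzag_val_Bwd[OF zz_fwd_bwd])
  then show ?case using T_inv(2)[OF zz_fwd_bwd] by simp
next
  case (zz_bwd_fwd s a b)
  have "zigzag_val C B T b ([Bwd s] @ [Fwd s]) = on_mor T s \<cdot>\<^bsub>B\<^esub> inv_mor B (on_mor T s)"
    by (simp only: zigzag_val_append[OF zigzag_Fwd[OF C zz_bwd_fwd(2)] zigzag_Bwd[OF C zz_bwd_fwd]]
        zigzag_val_Fwd[OF zz_bwd_fwd(2)] zigzag_val_Bwd[OF zz_bwd_fwd])
  then show ?case using T_inv(3)[OF zz_bwd_fwd] by simp
qed auto

private definition "T' = \<lparr>on_obj = on_obj T,
  on_mor = (\<lambda>(a, P, b). zigzag_val C B T a (SOME p. p \<in> P))\<rparr>"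

private lemma T'_frac:
  assumes "zigzag C S a p b"
  shows "on_mor T' (frac C S a p b) = zigzag_val C B T a p"
proof -
  have "zigzag_eq C S a b p (SOME q. zigzag_eq C S a b p q)"
    using zz_refl[OF assms] by (rule someI)
  from zigzag_val_eq[OF this] show ?thesis by (simp add: T'_def frac_def)
qed

private lemma T'_obj: "on_obj T' a = on_obj T a"
  by (simp add: T'_def)

lemma fractions_universal_ex:
  "\<exists>U. is_functor (fractions C S) B U \<and> func_eq C (comp_func U (to_fractions C S)) T"
proof (intro exI conjI)
  show "is_functor (fractions C S) B T'"
    unfolding is_functor_def
  proof (intro conjI ballI allI)
    show "category (fractions C S)" "category B" using B category_fractions[OF C] by auto
    fix a assume a: "a \<in> Obj (fractions C S)"
    then show "on_obj T' a \<in> Obj B" by (simp add: T'_obj T_obj fractions_simps)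
    have "zigzag C S a [] a" using a by (simp add: fractions_simps)
    from T'_frac[OF this] show "on_mor T' (Id (fractions C S) a) = Id B (on_obj T' a)"
      by (simp add: fractions_simps T'_obj)
  next
    fix a b f assume "f \<in> Hom (fractions C S) a b"
    then show "on_mor T' f \<in> Hom B (on_obj T' a) (on_obj T' b)"
      by (auto simp: Hom_fractions T'_frac T'_obj zigzag_val_hom)
  next
    fix a b c f g assume "f \<in> Hom (fractions C S) a b" "g \<in> Hom (fractions C S) b c"
    then show "on_mor T' (g \<cdot>\<^bsub>fractions C S\<^esub> f) = on_mor T' g \<cdot>\<^bsub>B\<^esub> on_mor T' f"
      by (auto simp: Hom_fractions T'_frac frac_comp zigzag_val_append zigzag_append)
  qed
  show "func_eq C (comp_func T' (to_fractions C S)) T"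
    unfolding func_eq_def
  proof (intro conjI ballI)
    fix a show "on_obj (comp_func T' (to_fractions C S)) a = on_obj T a"
      by (simp add: comp_func_def to_fractions_def T'_obj)
  next
    fix f assume "f \<in> Mor C"
    then have f: "f \<in> Hom C (Dom C f) (Cod C f)" by (rule Hom_morI)
    show "on_mor (comp_func T' (to_fractions C S)) f = on_mor T f"
      using T'_frac[OF zigzag_Fwd[OF C f]] zigzag_val_Fwd[OF f]
      by (simp add: comp_func_def on_mor_to_fractions[OF f])
  qed
qed

private lemma U_frac:
  assumes U: "is_functor (fractions C S) B U"
    and UT: "func_eq C (comp_func U (to_fractions C S)) T"
  shows "zigzag C S a p b \<Longrightarrow> on_mor U (frac C S a p b) = zigzag_val C B T a p"
proof (induction p arbitrary: a)
  have Uo: "on_obj U a = on_obj T a" if "a \<in> Obj C" for a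
    using UT that by (simp add: func_eq_def comp_func_def to_fractions_def)
  have Um: "on_mor U (frac C S a [Fwd f] b) = on_mor T f" if "f \<in> Hom C a b" for f a b
    using UT that by (auto simp: func_eq_def comp_func_def to_fractions_def Hom_def)
  have Uid: "on_mor U (frac C S a [] a) = Id B (on_obj T a)" if "a \<in> Obj C" for a
    using U that Uo by (simp add: is_functor_def fractions_simps)
  have Uc: "on_mor U (frac C S a (p @ q) c) = on_mor U (frac C S b q c) \<cdot>\<^bsub>B\<^esub> on_mor U (frac C S a p b)"
    if "zigzag C S a p b" "zigzag C S b q c" for a b c p q
  proof -
    have "frac C S a p b \<in> Hom (fractions C S) a b" "frac C S b q c \<in> Hom (fractions C S) b c"
      using that by (simp_all add: frac_hom)
    then show ?thesis using U frac_comp[OF that] unfolding is_functor_def by metis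
  qed
  {
    case Nil
    then have "b = a" "a \<in> Obj C" by auto
    then show ?case using Uid[of a] by simp
  next
    case (Cons x p)
    show ?case
    proof (cases x)
      case (Fwd f)
      with Cons have p: "zigzag C S (Cod C f) p b" and f: "f \<in> Hom C a (Cod C f)"
        by (auto simp: Hom_def)
      show ?thesis
        using Uc[OF zigzag_Fwd[OF C f] p] Cons.IH[OF p] Um[OF f] Fwd by simp
    next
      case (Bwd s)
      with Cons have p: "zigzag C S (Dom C s) p b" and s: "s \<in> S" "s \<in> Hom C (Dom C s) a"
        by (auto simp: Hom_def)
      note F = zigzag_Fwd[OF C s(2), of S] and R = zigzag_Bwd[where S = S, OF C s]
      have ab: "Dom C s \<in> Obj C" "a \<in> Obj C" using zigzag_ends[OF C F] by auto
      have "frac C S (Dom C s) ([Fwd s] @ [Bwd s]) (Dom C s) = frac C S (Dom C s) [] (Dom C s)"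
        using ab zz_fwd_bwd[OF s] by (simp add: frac_eq_iff)
      then have 1: "on_mor U (frac C S a [Bwd s] (Dom C s)) \<cdot>\<^bsub>B\<^esub> on_mor T s = Id B (on_obj T (Dom C s))"
        using Uc[OF F R] Uid[OF ab(1)] Um[OF s(2)] by simp
      have "frac C S a ([Bwd s] @ [Fwd s]) a = frac C S a [] a"
        using ab zz_bwd_fwd[OF s] by (simp add: frac_eq_iff)
      then have 2: "on_mor T s \<cdot>\<^bsub>B\<^esub> on_mor U (frac C S a [Bwd s] (Dom C s)) = Id B (on_obj T a)"
        using Uc[OF R F] Uid[OF ab(2)] Um[OF s(2)] by simp
      have "frac C S a [Bwd s] (Dom C s) \<in> Hom (fractions C S) a (Dom C s)"
        by (rule frac_hom[OF R])
      then have "on_mor U (frac C S a [Bwd s] (Dom C s)) \<in> Hom B (on_obj T a) (on_obj T (Dom C s))"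
        using U Uo[OF ab(1)] Uo[OF ab(2)] unfolding is_functor_def by metis
      then have "on_mor U (frac C S a [Bwd s] (Dom C s)) = inv_mor B (on_mor T s)"
        using 1 2 by (intro inv_mor_unique[OF B T_hom[OF s(2)]])
      then show ?thesis
        using Uc[OF R p] Cons.IH[OF p] Bwd by simp
    qed
  }
qed

lemma fractions_universal_unique:
  assumes U: "is_functor (fractions C S) B U" "func_eq C (comp_func U (to_fractions C S)) T"
    and V: "is_functor (fractions C S) B V" "func_eq C (comp_func V (to_fractions C S)) T"
  shows "func_eq (fractions C S) U V"
proof -
  have "on_obj U a = on_obj V a" if "a \<in> Obj C" for a
    using U(2) V(2) that by (simp add: func_eq_def comp_func_def to_fractions_def)
  moreover have "on_mor U f = on_mor V f" if "f \<in> Mor (fractions C S)" for f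
    using that U_frac[OF U] U_frac[OF V] by (auto simp: fractions_def)
  ultimately show ?thesis by (simp add: func_eq_def fractions_simps)
qed

end

theorem fractions_universal:
  assumes "is_functor C B T" and "\<And>s. \<lbrakk>s \<in> S; s \<in> Mor C\<rbrakk> \<Longrightarrow> is_iso B (on_mor T s)"
  shows "\<exists>U. is_functor (fractions C S) B U \<and> func_eq C (comp_func U (to_fractions C S)) T \<and>
    (\<forall>V. is_functor (fractions C S) B V \<and> func_eq C (comp_func V (to_fractions C S)) T
       \<longrightarrow> func_eq (fractions C S) U V)"
proof -
  obtain U where U: "is_functor (fractions C S) B U"
      "func_eq C (comp_func U (to_fractions C S)) T"
    using fractions_universal_ex[of C B T S] assms by auto
  have "func_eq (fractions C S) U V"
    if "is_functor (fractions C S) B V" "func_eq C (comp_func V (to_fractions C S)) T" for V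
    by (rule fractions_universal_unique[OF assms(1) assms(2) U that])
  with U show ?thesis by (intro exI[of _ U]) simp
qed

end

theory Submission
  imports Defs
begin

text \<open>All the classes of morphisms in question equal the class \<open>W\<close> of the morphisms inverted by \<open>F\<close>.
  Having adjoints on both sides, \<open>F\<close> preserves monos and epis, and being faithful it reflects them, so
  in the balanced case \<open>W\<close> is the class of bimorphisms. Both adjoints are fully faithful, so every
  object of \<open>X\<close> is isomorphic to some \<open>F y\<close> such that all maps \<open>F a \<rightarrow> F y\<close> come from \<open>C\<close>, and dually.
  Lifting maps in this way shows that \<open>W\<close> consists of pullback stable essential monos and that
  \<open>F\<close> preserves these, hence inverts them by hypothesis (i). This situation is self-dual, which
  gives the statements about the opposite category; and inverting \<open>W\<close> makes the reflection \<open>F\<close> an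
  equivalence.\<close>

section \<open>Monomorphisms and isomorphisms\<close>

lemma is_iso_opp: "is_iso (opp C) f \<longleftrightarrow> is_iso C f"
  by (auto simp: is_iso_def Hom_opp)

lemma is_mono_opp: "is_mono (opp C) f \<longleftrightarrow> is_epi C f"
  by (simp add: is_mono_def is_epi_def Hom_opp)

lemma faithful_opp: "faithful (opp C) F \<longleftrightarrow> faithful C F"
  unfolding faithful_def Hom_opp by auto

lemma opp_func_eq: "opp_func F = F"
  by (simp add: opp_func_def)

lemma is_monoI:
  assumes "f \<in> Hom C a b"
    and "\<And>c g h. \<lbrakk>g \<in> Hom C c a; h \<in> Hom C c a; f \<cdot>\<^bsub>C\<^esub> g = f \<cdot>\<^bsub>C\<^esub> h\<rbrakk> \<Longrightarrow> g = h"
  shows "is_mono C f"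
proof -
  have "f \<in> Mor C" "Dom C f = a" using assms(1) by (simp_all add: Hom_def)
  then show ?thesis using assms(2) by (auto simp: is_mono_def)
qed

lemma is_monoD:
  assumes "is_mono C f" "f \<in> Hom C a b" "g \<in> Hom C c a" "h \<in> Hom C c a" "f \<cdot>\<^bsub>C\<^esub> g = f \<cdot>\<^bsub>C\<^esub> h"
  shows "g = h"
proof -
  have "Dom C f = a" using assms(2) by (simp add: Hom_def)
  then show ?thesis using assms by (auto simp: is_mono_def)
qed

lemma is_isoI:
  assumes "f \<in> Hom C a b" "g \<in> Hom C b a" "g \<cdot>\<^bsub>C\<^esub> f = Id C a" "f \<cdot>\<^bsub>C\<^esub> g = Id C b"
  shows "is_iso C f"
  using assms by (auto simp: is_iso_def Hom_def)

lemma is_isoE: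
  assumes "is_iso C f" "f \<in> Hom C a b"
  obtains g where "g \<in> Hom C b a" "g \<cdot>\<^bsub>C\<^esub> f = Id C a" "f \<cdot>\<^bsub>C\<^esub> g = Id C b"
  using assms by (auto simp: is_iso_def Hom_def)

context category
begin

lemma Hom_obj:
  assumes "f \<in> Hom C a b"
  shows "a \<in> Obj C" "b \<in> Obj C"
  using assms dom_obj cod_obj by (auto simp: Hom_def)

lemma iso_inverse: "\<lbrakk>f \<in> Hom C a b; g \<in> Hom C b a; g \<cdot> f = Id C a; f \<cdot> g = Id C b\<rbrakk> \<Longrightarrow> is_iso C g"
  by (rule is_isoI[of g C b a f]) auto

lemma retraction_cancel:
  assumes "f \<in> Hom C a b" "r \<in> Hom C b a" "r \<cdot> f = Id C a" "g \<in> Hom C c a"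
  shows "r \<cdot> (f \<cdot> g) = g"
  using comp_assoc[OF assms(4,1,2)] id_left[OF assms(4)] assms(3) by simp

lemma section_cancel:
  assumes "f \<in> Hom C a b" "s \<in> Hom C b a" "f \<cdot> s = Id C b" "g \<in> Hom C b c"
  shows "(g \<cdot> f) \<cdot> s = g"
  using comp_assoc[OF assms(2,1,4)] id_right[OF assms(4)] assms(3) by simp

lemma split_mono:
  assumes f: "f \<in> Hom C a b" and r: "r \<in> Hom C b a" "r \<cdot> f = Id C a"
  shows "is_mono C f"
  using f retraction_cancel[OF f r] by (metis is_monoI)

lemma iso_mono: "is_iso C f \<Longrightarrow> is_mono C f"
  by (metis Hom_morI is_isoE is_iso_def split_mono)

lemma mono_comp:
  assumes f: "f \<in> Hom C a b" "is_mono C f" and g: "g \<in> Hom C b c" "is_mono C g"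
  shows "is_mono C (g \<cdot> f)"
proof (rule is_monoI[OF comp_hom[OF f(1) g(1)]])
  fix d h k assume hk: "h \<in> Hom C d a" "k \<in> Hom C d a" "g \<cdot> f \<cdot> h = g \<cdot> f \<cdot> k"
  then have "f \<cdot> h = f \<cdot> k"
    using is_monoD[OF g(2,1) comp_hom[OF hk(1) f(1)] comp_hom[OF hk(2) f(1)]]
      comp_assoc[OF _ f(1) g(1)] by metis
  with hk show "h = k" using is_monoD[OF f(2,1)] by blast
qed

lemma mono_cancel:
  assumes f: "f \<in> Hom C a b" and g: "g \<in> Hom C b c" and "is_mono C (g \<cdot> f)"
  shows "is_mono C f"
proof (rule is_monoI[OF f])
  fix d h k assume hk: "h \<in> Hom C d a" "k \<in> Hom C d a" "f \<cdot> h = f \<cdot> k"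
  then have "g \<cdot> f \<cdot> h = g \<cdot> f \<cdot> k" using comp_assoc[OF _ f g] by metis
  with hk show "h = k" using is_monoD[OF assms(3) comp_hom[OF f g]] by blast
qed

text \<open>With \<open>s\<close> the inverse of \<open>f\<close>, the morphism \<open>g\<close>
  equals \<open>g \<cdot> f \<cdot> s\<close>, a composite of monos.\<close>

lemma mono_precomp_iso_cancel:
  assumes f: "f \<in> Hom C a b" and g: "g \<in> Hom C b c" and "is_mono C (g \<cdot> f)" and "is_iso C f"
  shows "is_mono C g"
proof -
  obtain s where s: "s \<in> Hom C b a" "s \<cdot> f = Id C a" "f \<cdot> s = Id C b"
    using is_isoE assms(4) f by metis
  have "is_mono C s" using iso_mono iso_inverse[OF f s] by blast
  then have "is_mono C ((g \<cdot> f) \<cdot> s)"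
    using mono_comp[OF s(1) _ comp_hom[OF f g]] assms(3) by blast
  then show ?thesis using section_cancel[OF f s(1,3) g] by simp
qed

text \<open>From \<open>f \<cdot> s \<cdot> f = f\<close> the mono \<open>f\<close> can be cancelled
  on the left, so the section \<open>s\<close> is a two-sided inverse.\<close>

lemma mono_split_epi_iso:
  assumes f: "f \<in> Hom C a b" "is_mono C f" and s: "s \<in> Hom C b a" "f \<cdot> s = Id C b"
  shows "is_iso C f"
proof -
  have "f \<cdot> (s \<cdot> f) = f \<cdot> Id C a"
    using comp_assoc[OF f(1) s(1) f(1)] s(2) id_left[OF f(1)] id_right[OF f(1)] by simp
  then have "s \<cdot> f = Id C a"
    using is_monoD[OF f(2,1) comp_hom[OF f(1) s(1)] id_hom] Hom_obj[OF f(1)] by blast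
  then show ?thesis using is_isoI[OF f(1) s(1)] s(2) by blast
qed

end

section \<open>Pullback squares and stability of monos\<close>

context category
begin

text \<open>Existence and uniqueness of mediating maps are separated. Uniqueness takes the form that
  \<open>p\<close> and \<open>q\<close> are jointly monic: \<open>h\<close> and \<open>k\<close>
  both mediate the cone formed by \<open>p \<cdot> h\<close> and \<open>q \<cdot> h\<close>.\<close>

lemma is_pullbackE:
  assumes pb: "is_pullback C f g p q" and f: "f \<in> Hom C a c" and g: "g \<in> Hom C b c"
  obtains d where "p \<in> Hom C d a" "q \<in> Hom C d b" "f \<cdot> p = g \<cdot> q"
    "\<And>t x y. \<lbrakk>x \<in> Hom C t a; y \<in> Hom C t b; f \<cdot> x = g \<cdot> y\<rbrakk>
      \<Longrightarrow> \<exists>h\<in>Hom C t d. p \<cdot> h = x \<and> q \<cdot> h = y"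
    "\<And>t h k. \<lbrakk>h \<in> Hom C t d; k \<in> Hom C t d; p \<cdot> h = p \<cdot> k; q \<cdot> h = q \<cdot> k\<rbrakk> \<Longrightarrow> h = k"
proof -
  define d where "d = Dom C p"
  have fg: "Dom C f = a" "Dom C g = b" using f g by (simp_all add: Hom_def)
  have p: "p \<in> Hom C d a" and q: "q \<in> Hom C d b" and sq: "f \<cdot> p = g \<cdot> q"
    using pb fg by (auto simp: is_pullback_def d_def Hom_def)
  have U: "\<exists>!h. h \<in> Hom C t d \<and> p \<cdot> h = x \<and> q \<cdot> h = y"
    if "x \<in> Hom C t a" "y \<in> Hom C t b" "f \<cdot> x = g \<cdot> y" for t x y
    using pb that unfolding is_pullback_def d_def fg by blast
  have "\<exists>h\<in>Hom C t d. p \<cdot> h = x \<and> q \<cdot> h = y"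
    if "x \<in> Hom C t a" "y \<in> Hom C t b" "f \<cdot> x = g \<cdot> y" for t x y
    using ex1_implies_ex[OF U[OF that]] by blast
  moreover have "h = k"
    if "h \<in> Hom C t d" "k \<in> Hom C t d" "p \<cdot> h = p \<cdot> k" "q \<cdot> h = q \<cdot> k" for t h k
  proof -
    have "f \<cdot> (p \<cdot> h) = g \<cdot> (q \<cdot> h)"
      using comp_assoc[OF that(1) p f] comp_assoc[OF that(1) q g] sq by simp
    from U[OF comp_hom[OF that(1) p] comp_hom[OF that(1) q] this] show ?thesis
      using that by auto
  qed
  ultimately show ?thesis by (rule that[OF p q sq])
qed

text \<open>If \<open>q\<close> identifies two maps then so does \<open>f \<cdot> p\<close>, hence
  \<open>p\<close> because \<open>f\<close> is mono, and the projections are jointly monic.\<close>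

lemma pullback_mono:
  assumes pb: "is_pullback C f g p q" and f: "f \<in> Hom C a c" "is_mono C f" and g: "g \<in> Hom C b c"
  shows "is_mono C q"
proof -
  obtain d where p: "p \<in> Hom C d a" and q: "q \<in> Hom C d b" and sq: "f \<cdot> p = g \<cdot> q"
    and U: "\<And>t h k. \<lbrakk>h \<in> Hom C t d; k \<in> Hom C t d; p \<cdot> h = p \<cdot> k; q \<cdot> h = q \<cdot> k\<rbrakk> \<Longrightarrow> h = k"
    by (rule is_pullbackE[OF pb f(1) g]) (rule that; blast)
  show ?thesis
  proof (rule is_monoI[OF q])
    fix t h k assume hk: "h \<in> Hom C t d" "k \<in> Hom C t d" and eq: "q \<cdot> h = q \<cdot> k"
    have "f \<cdot> (p \<cdot> h) = f \<cdot> (p \<cdot> k)"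
      using comp_assoc[OF hk(1) p f(1)] comp_assoc[OF hk(2) p f(1)] sq eq
        comp_assoc[OF hk(1) q g] comp_assoc[OF hk(2) q g] by simp
    then have "p \<cdot> h = p \<cdot> k"
      using is_monoD[OF f(2,1) comp_hom[OF hk(1) p] comp_hom[OF hk(2) p]] by simp
    then show "h = k" using U[OF hk] eq by simp
  qed
qed

end

section \<open>Pullbacks as limits of cospans\<close>

definition has_pullbacks :: "('o, 'm) cat \<Rightarrow> bool" where
  "has_pullbacks C \<longleftrightarrow>
     (\<forall>a b c. \<forall>f\<in>Hom C a c. \<forall>g\<in>Hom C b c. \<exists>p q. is_pullback C f g p q)"

text \<open>The shape \<open>0 \<rightarrow> 2 \<leftarrow> 1\<close>: the morphisms \<open>0, 1, 2\<close> are the identities, \<open>3 : 0 \<rightarrow> 2\<close> and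
  \<open>4 : 1 \<rightarrow> 2\<close>.\<close>

definition cospan_shape :: "(nat, nat) cat" where
  "cospan_shape = \<lparr>Obj = {0, 1, 2}, Mor = {0, 1, 2, 3, 4},
     Dom = (\<lambda>u. if u < 3 then u else u - 3), Cod = (\<lambda>u. if u < 3 then u else 2),
     Id = (\<lambda>i. i), Comp = (\<lambda>v u. if v < 3 then u else v)\<rparr>"

lemma cospan_shape_category: "category cospan_shape"
  by unfold_locales (auto simp: cospan_shape_def Hom_def)

lemma Obj_cospan_shape: "Obj cospan_shape = {0, 1, 2}"
  by (simp add: cospan_shape_def)

lemma Hom_cospan_shape:
  "u \<in> Hom cospan_shape i j \<longleftrightarrow>
     u \<in> {0, 1, 2} \<and> i = u \<and> j = u \<or> u = 3 \<and> i = 0 \<and> j = 2 \<or> u = 4 \<and> i = 1 \<and> j = 2"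
  by (auto simp: cospan_shape_def Hom_def)

lemma (in category) has_pullbacksI:
  assumes "has_finite_limits C"
  shows "has_pullbacks C"
  unfolding has_pullbacks_def
proof (intro allI ballI)
  fix a b c f g assume f: "f \<in> Hom C a c" and g: "g \<in> Hom C b c"
  note objs = Hom_obj[OF f] Hom_obj[OF g]
  define obj where "obj = (\<lambda>i::nat. if i = 0 then a else if i = 1 then b else c)"
  define mor where "mor = (\<lambda>u::nat. if u < 3 then Id C (obj u) else if u = 3 then f else g)"
  define D where "D = \<lparr>on_obj = obj, on_mor = mor\<rparr>"
  have mor_hom: "mor u \<in> Hom C (obj i) (obj j)" if "u \<in> Hom cospan_shape i j" for u i j
    using that f g id_hom objs by (auto simp: Hom_cospan_shape mor_def obj_def)
  have "is_functor cospan_shape C D"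
    unfolding is_functor_def
  proof (intro conjI ballI allI)
    show "category cospan_shape" "category C"
      by (rule cospan_shape_category) (rule category_axioms)
    show "on_mor D (v \<cdot>\<^bsub>cospan_shape\<^esub> u) = on_mor D v \<cdot> on_mor D u"
      if u: "u \<in> Hom cospan_shape i j" and v: "v \<in> Hom cospan_shape j k" for i j k u v
    proof (cases "v < 3")
      case True
      then have "mor v = Id C (obj j)" using v by (auto simp: Hom_cospan_shape mor_def)
      then show ?thesis using True id_left[OF mor_hom[OF u]] by (simp add: D_def cospan_shape_def)
    next
      case False
      then have "mor u = Id C (obj j)" using u v by (auto simp: Hom_cospan_shape mor_def)
      then show ?thesis using False id_right[OF mor_hom[OF v]] by (simp add: D_def cospan_shape_def)
    qed
  qed (use mor_hom objs in \<open>auto simp: D_def cospan_shape_def obj_def mor_def\<close>)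
  then have "finite_diagram cospan_shape C D"
    by (simp add: finite_diagram_def cospan_shape_def)
  then obtain l p where "is_limit cospan_shape C D l p"
    using assms unfolding has_finite_limits_def by blast
  then have l: "is_cone cospan_shape C D l p"
    and U: "\<And>k q. is_cone cospan_shape C D k q \<Longrightarrow>
      \<exists>!h. h \<in> Hom C k l \<and> (\<forall>i\<in>Obj cospan_shape. p i \<cdot> h = q i)"
    by (auto simp: is_limit_def)
  \<comment> \<open>A cone over the cospan amounts to a commutative square; its leg at
    \<open>2\<close> is the common composite, hence determined by the other two legs.\<close>
  have cone_iff: "is_cone cospan_shape C D k q \<longleftrightarrow>
      q 0 \<in> Hom C k a \<and> q 1 \<in> Hom C k b \<and> f \<cdot> q 0 = q 2 \<and> g \<cdot> q 1 = q 2" for k q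
  proof
    assume c: "is_cone cospan_shape C D k q"
    then have "q 0 \<in> Hom C k a" "q 1 \<in> Hom C k b"
      by (auto simp: is_cone_def D_def obj_def cospan_shape_def)
    moreover have "on_mor D u \<cdot> q i = q j" if "u \<in> Hom cospan_shape i j" for u i j
      using c that by (auto simp: is_cone_def)
    from this[of 3 0 2] this[of 4 1 2] have "f \<cdot> q 0 = q 2" "g \<cdot> q 1 = q 2"
      by (auto simp: Hom_cospan_shape D_def mor_def)
    ultimately show "q 0 \<in> Hom C k a \<and> q 1 \<in> Hom C k b \<and> f \<cdot> q 0 = q 2 \<and> g \<cdot> q 1 = q 2"
      by blast
  next
    assume q: "q 0 \<in> Hom C k a \<and> q 1 \<in> Hom C k b \<and> f \<cdot> q 0 = q 2 \<and> g \<cdot> q 1 = q 2"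
    then have "q 2 \<in> Hom C k c" using comp_hom f by metis
    moreover from this have "on_mor D u \<cdot> q i = q j" if "u \<in> Hom cospan_shape i j" for u i j
      using that q id_left by (auto simp: Hom_cospan_shape D_def obj_def mor_def)
    moreover have "k \<in> Obj C" using q Hom_obj by blast
    ultimately show "is_cone cospan_shape C D k q"
      using q by (auto simp: is_cone_def D_def obj_def Obj_cospan_shape)
  qed
  have p: "p 0 \<in> Hom C l a" "p 1 \<in> Hom C l b" "f \<cdot> p 0 = p 2" "g \<cdot> p 1 = p 2"
    using l by (auto simp: cone_iff)
  have "\<exists>!h. h \<in> Hom C t l \<and> p 0 \<cdot> h = x \<and> p 1 \<cdot> h = y"
    if x: "x \<in> Hom C t a" and y: "y \<in> Hom C t b" and eq: "f \<cdot> x = g \<cdot> y" for t x y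
  proof -
    define q where "q = (\<lambda>i::nat. if i = 0 then x else if i = 1 then y else f \<cdot> x)"
    have "is_cone cospan_shape C D t q" using x y eq by (simp add: cone_iff q_def)
    from U[OF this] have "\<exists>!h. h \<in> Hom C t l \<and> p 0 \<cdot> h = x \<and> p 1 \<cdot> h = y \<and> p 2 \<cdot> h = f \<cdot> x"
      by (simp add: cospan_shape_def q_def)
    \<comment> \<open>The equation at \<open>2\<close> follows from the one at \<open>0\<close>,
      which turns the limit property into the pullback property.\<close>
    moreover have "p 2 \<cdot> h = f \<cdot> x" if "h \<in> Hom C t l" "p 0 \<cdot> h = x" for h
      using comp_assoc[OF that(1) p(1) f] that(2) p(3) by simp
    ultimately show ?thesis by metis
  qed
  then have "is_pullback C f g (p 0) (p 1)"
    using f g p unfolding is_pullback_def Hom_def by auto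
  then show "\<exists>p q. is_pullback C f g p q" by blast
qed

section \<open>Faithful functors with adjoints on both sides\<close>

text \<open>For faithful \<open>F\<close> this says that \<open>F\<close> has a right adjoint whose counit is invertible, in a form
  that avoids choosing the adjoint; in the opposite categories it speaks of a left adjoint with
  invertible unit.\<close>

definition has_full_lifts ::
  "('o, 'm) cat \<Rightarrow> ('p, 'n) cat \<Rightarrow> ('o, 'm, 'p, 'n) func \<Rightarrow> bool" where
  "has_full_lifts C X F \<longleftrightarrow>
     (\<forall>x\<in>Obj X. \<exists>y\<in>Obj C. \<exists>e\<in>Hom X (on_obj F y) x. is_iso X e \<and>
        (\<forall>a. \<forall>w\<in>Hom X (on_obj F a) (on_obj F y). a \<in> Obj C \<longrightarrow> (\<exists>v\<in>Hom C a y. on_mor F v = w)))"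

lemma has_full_liftsE:
  assumes "has_full_lifts C X F" "x \<in> Obj X"
  obtains y e where "y \<in> Obj C" "e \<in> Hom X (on_obj F y) x" "is_iso X e"
    "\<And>a w. \<lbrakk>a \<in> Obj C; w \<in> Hom X (on_obj F a) (on_obj F y)\<rbrakk> \<Longrightarrow> \<exists>v\<in>Hom C a y. on_mor F v = w"
  using assms unfolding has_full_lifts_def by auto

text \<open>The situation in self-dual form: passing to opposite categories exchanges the two
  lifting assumptions and keeps the others, so everything proved here also holds dually.\<close>

locale faithful_bilift = C: category C + X: category X
  for C :: "('o, 'm) cat" and X :: "('p, 'n) cat" +
  fixes F :: "('o, 'm, 'p, 'n) func"
  assumes F: "is_functor C X F" and faithful: "faithful C F"
    and right_lifts: "has_full_lifts C X F" and left_lifts: "has_full_lifts (opp C) (opp X) F"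
begin

abbreviation "Fo \<equiv> on_obj F"
abbreviation "Fm \<equiv> on_mor F"

lemma F_obj: "a \<in> Obj C \<Longrightarrow> Fo a \<in> Obj X"
  and F_hom: "f \<in> Hom C a b \<Longrightarrow> Fm f \<in> Hom X (Fo a) (Fo b)"
  and F_comp: "\<lbrakk>f \<in> Hom C a b; g \<in> Hom C b c\<rbrakk> \<Longrightarrow> Fm (g \<cdot>\<^bsub>C\<^esub> f) = Fm g \<cdot>\<^bsub>X\<^esub> Fm f"
  using F unfolding is_functor_def by blast+

lemma F_inj: "\<lbrakk>f \<in> Hom C a b; g \<in> Hom C a b; Fm f = Fm g\<rbrakk> \<Longrightarrow> f = g"
  using faithful C.Hom_obj unfolding faithful_def by blast

lemma dual: "faithful_bilift (opp C) (opp X) F"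
  by (intro faithful_bilift.intro faithful_bilift_axioms.intro)
    (use F faithful right_lifts left_lifts C.category_axioms X.category_axioms is_functor_opp[of C X F]
      in \<open>simp_all add: category_opp faithful_opp opp_opp opp_func_eq\<close>)

text \<open>The isomorphism from \<open>left_lifts\<close> is turned around to run from
  \<open>Fo y\<close> to \<open>x\<close>: precomposition with it changes maps out of
  \<open>x\<close> into maps out of \<open>Fo y\<close>, which can be lifted.\<close>

lemma left_liftE:
  assumes "x \<in> Obj X"
  obtains y j where "y \<in> Obj C" "j \<in> Hom X (Fo y) x" "is_iso X j"
    "\<And>a w. \<lbrakk>a \<in> Obj C; w \<in> Hom X (Fo y) (Fo a)\<rbrakk> \<Longrightarrow> \<exists>v\<in>Hom C y a. Fm v = w"
proof -
  obtain y e where y: "y \<in> Obj C" "e \<in> Hom X x (Fo y)" "is_iso X e"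
    "\<And>a w. \<lbrakk>a \<in> Obj C; w \<in> Hom X (Fo y) (Fo a)\<rbrakk> \<Longrightarrow> \<exists>v\<in>Hom C y a. Fm v = w"
    using left_lifts assms unfolding has_full_lifts_def by (auto simp: Hom_opp is_iso_opp)
  obtain j where "j \<in> Hom X (Fo y) x" "j \<cdot>\<^bsub>X\<^esub> e = Id X x" "e \<cdot>\<^bsub>X\<^esub> j = Id X (Fo y)"
    using is_isoE[OF y(3,2)] by blast
  then show ?thesis using that y X.iso_inverse[OF y(2)] by blast
qed

lemma right_liftE:
  assumes "x \<in> Obj X"
  obtains y k where "y \<in> Obj C" "k \<in> Hom X x (Fo y)" "is_iso X k"
    "\<And>a w. \<lbrakk>a \<in> Obj C; w \<in> Hom X (Fo a) (Fo y)\<rbrakk> \<Longrightarrow> \<exists>v\<in>Hom C a y. Fm v = w"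
  using faithful_bilift.left_liftE[OF dual] assms by (simp add: Hom_opp is_iso_opp) metis

section \<open>Monos, epis and bimorphisms under \<open>F\<close>\<close>

lemma reflects_mono:
  assumes f: "f \<in> Hom C a b" and m: "is_mono X (Fm f)"
  shows "is_mono C f"
proof (rule is_monoI[OF f])
  fix c g h assume gh: "g \<in> Hom C c a" "h \<in> Hom C c a" "f \<cdot>\<^bsub>C\<^esub> g = f \<cdot>\<^bsub>C\<^esub> h"
  then have "Fm f \<cdot>\<^bsub>X\<^esub> Fm g = Fm f \<cdot>\<^bsub>X\<^esub> Fm h" using F_comp[OF _ f] by metis
  then show "g = h" using is_monoD[OF m F_hom[OF f] F_hom F_hom] F_inj gh by metis
qed

lemma preserves_mono:
  assumes f: "f \<in> Hom C a b" and m: "is_mono C f"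
  shows "is_mono X (Fm f)"
proof (rule is_monoI[OF F_hom[OF f]])
  fix x g h assume g: "g \<in> Hom X x (Fo a)" and h: "h \<in> Hom X x (Fo a)"
    and eq: "Fm f \<cdot>\<^bsub>X\<^esub> g = Fm f \<cdot>\<^bsub>X\<^esub> h"
  \<comment> \<open>The test maps start at an arbitrary \<open>x\<close> and need not come from
    \<open>C\<close>; after precomposing with \<open>j\<close> they start at \<open>Fo y\<close> and
    do.\<close>
  obtain y j where y: "y \<in> Obj C" and j: "j \<in> Hom X (Fo y) x" "is_iso X j"
    and L: "\<And>a w. \<lbrakk>a \<in> Obj C; w \<in> Hom X (Fo y) (Fo a)\<rbrakk> \<Longrightarrow> \<exists>v\<in>Hom C y a. Fm v = w"
    using left_liftE X.Hom_obj(1)[OF g] by metis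
  obtain i where i: "i \<in> Hom X x (Fo y)" "j \<cdot>\<^bsub>X\<^esub> i = Id X x" using is_isoE[OF j(2,1)] by metis
  have a: "a \<in> Obj C" using C.Hom_obj[OF f] by simp
  obtain v where v: "v \<in> Hom C y a" "Fm v = g \<cdot>\<^bsub>X\<^esub> j" using L[OF a X.comp_hom[OF j(1) g]] by blast
  obtain w where w: "w \<in> Hom C y a" "Fm w = h \<cdot>\<^bsub>X\<^esub> j" using L[OF a X.comp_hom[OF j(1) h]] by blast
  have "Fm (f \<cdot>\<^bsub>C\<^esub> v) = Fm (f \<cdot>\<^bsub>C\<^esub> w)"
    using F_comp[OF v(1) f] F_comp[OF w(1) f] v(2) w(2) eq
      X.comp_assoc[OF j(1) g F_hom[OF f]] X.comp_assoc[OF j(1) h F_hom[OF f]] by simp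
  then have "f \<cdot>\<^bsub>C\<^esub> v = f \<cdot>\<^bsub>C\<^esub> w" using F_inj C.comp_hom[OF v(1) f] C.comp_hom[OF w(1) f] by blast
  then have "v = w" using is_monoD[OF m f v(1) w(1)] by blast
  then have "(g \<cdot>\<^bsub>X\<^esub> j) \<cdot>\<^bsub>X\<^esub> i = (h \<cdot>\<^bsub>X\<^esub> j) \<cdot>\<^bsub>X\<^esub> i" using v w by simp
  then show "g = h" using X.section_cancel[OF j(1) i g] X.section_cancel[OF j(1) i h] by simp
qed

lemma mono_iff: "f \<in> Mor C \<Longrightarrow> is_mono X (Fm f) \<longleftrightarrow> is_mono C f"
  using reflects_mono preserves_mono Hom_morI by metis

lemma epi_iff: "f \<in> Mor C \<Longrightarrow> is_epi X (Fm f) \<longleftrightarrow> is_epi C f"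
  using faithful_bilift.mono_iff[OF dual] by (simp add: is_mono_opp)

text \<open>In a balanced category the isomorphisms are exactly the bimorphisms, and
  \<open>F\<close> preserves and reflects both monos and epis.\<close>

lemma bimorphism_iff:
  assumes "balanced X"
  shows "bimorphism C f \<longleftrightarrow> f \<in> Mor C \<and> is_iso X (Fm f)"
proof -
  have "is_iso X g \<longleftrightarrow> bimorphism X g" for g
    using assms X.iso_mono category.iso_mono[OF category_opp[OF X.category_axioms], of g]
    unfolding balanced_def bimorphism_def is_mono_opp is_iso_opp by blast
  moreover have "bimorphism C f \<Longrightarrow> f \<in> Mor C" by (simp add: bimorphism_def is_mono_def)
  ultimately show ?thesis using mono_iff epi_iff by (auto simp: bimorphism_def)
qed

section \<open>Pullback stable essential monos and the morphisms inverted by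
  \<open>F\<close>\<close>

lemma inverted_essential_mono:
  assumes m: "m \<in> Hom C s a" and iso: "is_iso X (Fm m)"
  shows "essential_mono C m"
  unfolding essential_mono_def
proof (intro conjI allI ballI impI)
  show "is_mono C m" using reflects_mono[OF m] X.iso_mono[OF iso] by blast
next
  fix b f assume "f \<in> Hom C (Cod C m) b" and "is_mono C (f \<cdot>\<^bsub>C\<^esub> m)"
  moreover from this have f: "f \<in> Hom C a b" using m by (auto simp: Hom_def)
  ultimately have "is_mono X (Fm f \<cdot>\<^bsub>X\<^esub> Fm m)"
    using preserves_mono[OF C.comp_hom[OF m f]] F_comp[OF m f] by simp
  \<comment> \<open>The invertible \<open>Fm m\<close> cancels on the right, and faithfulness
    reflects the mono \<open>Fm f\<close>.\<close>
  then show "is_mono C f"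
    using reflects_mono[OF f] X.mono_precomp_iso_cancel[OF F_hom[OF m] F_hom[OF f]] iso by blast
qed

text \<open>\<open>F q\<close> is mono, and it is split: the required map \<open>F b \<rightarrow> F d\<close> is obtained by lifting the cone
  \<open>(F m)\<^sup>-\<^sup>1 \<circ> F u\<close>, \<open>id\<close> on \<open>F b\<close> to a cone on the left lift \<open>y\<close> of \<open>F b\<close>.\<close>

lemma inverted_pullback:
  assumes m: "m \<in> Hom C s a" "is_iso X (Fm m)" and u: "u \<in> Hom C b a"
    and pb: "is_pullback C m u p q"
  shows "is_iso X (Fm q)"
proof -
  obtain d where p: "p \<in> Hom C d s" and q: "q \<in> Hom C d b"
    and U: "\<And>t x y. \<lbrakk>x \<in> Hom C t s; y \<in> Hom C t b; m \<cdot>\<^bsub>C\<^esub> x = u \<cdot>\<^bsub>C\<^esub> y\<rbrakk>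
      \<Longrightarrow> \<exists>h\<in>Hom C t d. p \<cdot>\<^bsub>C\<^esub> h = x \<and> q \<cdot>\<^bsub>C\<^esub> h = y"
    by (rule C.is_pullbackE[OF pb m(1) u]) (rule that; blast)
  have obj: "s \<in> Obj C" "b \<in> Obj C" using C.Hom_obj m(1) u by blast+
  obtain y j where j: "j \<in> Hom X (Fo y) (Fo b)" "is_iso X j"
    and L: "\<And>a w. \<lbrakk>a \<in> Obj C; w \<in> Hom X (Fo y) (Fo a)\<rbrakk> \<Longrightarrow> \<exists>v\<in>Hom C y a. Fm v = w"
    using left_liftE F_obj[OF obj(2)] by metis
  obtain i where i: "i \<in> Hom X (Fo b) (Fo y)" "j \<cdot>\<^bsub>X\<^esub> i = Id X (Fo b)" using is_isoE[OF j(2,1)] by metis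
  obtain n where n: "n \<in> Hom X (Fo a) (Fo s)" "Fm m \<cdot>\<^bsub>X\<^esub> n = Id X (Fo a)"
    using is_isoE[OF m(2) F_hom[OF m(1)]] by metis
  obtain v where v: "v \<in> Hom C y b" "Fm v = j" using L[OF obj(2) j(1)] by blast
  have uv: "u \<cdot>\<^bsub>C\<^esub> v \<in> Hom C y a" by (rule C.comp_hom[OF v(1) u])
  obtain r where r: "r \<in> Hom C y s" "Fm r = n \<cdot>\<^bsub>X\<^esub> Fm (u \<cdot>\<^bsub>C\<^esub> v)"
    using L[OF obj(1) X.comp_hom[OF F_hom[OF uv] n(1)]] by blast
  have "Fm (m \<cdot>\<^bsub>C\<^esub> r) = Fm (u \<cdot>\<^bsub>C\<^esub> v)"
    using F_comp[OF r(1) m(1)] r(2) X.retraction_cancel[OF n(1) F_hom[OF m(1)] n(2) F_hom[OF uv]] by simp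
  then have "m \<cdot>\<^bsub>C\<^esub> r = u \<cdot>\<^bsub>C\<^esub> v" using F_inj[OF C.comp_hom[OF r(1) m(1)] uv] by blast
  then obtain h where h: "h \<in> Hom C y d" "q \<cdot>\<^bsub>C\<^esub> h = v" using U[OF r(1) v(1)] by blast
  \<comment> \<open>The section of \<open>Fm q\<close>: the image of \<open>q \<cdot> h = v\<close>
    is \<open>j\<close>, which \<open>i\<close> inverts on the right.\<close>
  have "Fm q \<cdot>\<^bsub>X\<^esub> (Fm h \<cdot>\<^bsub>X\<^esub> i) = Id X (Fo b)"
    using X.comp_assoc[OF i(1) F_hom[OF h(1)] F_hom[OF q]] F_comp[OF h(1) q] h(2) v(2) i(2) by simp
  moreover have "is_mono X (Fm q)"
    using preserves_mono[OF q] C.pullback_mono[OF pb m(1) reflects_mono[OF m(1)] u]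
      X.iso_mono[OF m(2)] by blast
  ultimately show ?thesis
    using X.mono_split_epi_iso[OF F_hom[OF q] _ X.comp_hom[OF i(1) F_hom[OF h(1)]]] by blast
qed

text \<open>Pullbacks of inverted morphisms are again inverted by \<open>inverted_pullback\<close>,
  hence essential by \<open>inverted_essential_mono\<close>.\<close>

lemma inverted_pullback_stable:
  assumes "m \<in> Mor C" "is_iso X (Fm m)"
  shows "pullback_stable_essential_mono C m"
  unfolding pullback_stable_essential_mono_def
proof (intro conjI allI impI)
  have m: "m \<in> Hom C (Dom C m) (Cod C m)" by (rule Hom_morI) fact
  then show "is_mono C m" using reflects_mono X.iso_mono[OF assms(2)] by blast
  fix u p q assume pb: "is_pullback C m u p q"
  then have u: "u \<in> Hom C (Dom C u) (Cod C m)" and q: "q \<in> Hom C (Dom C q) (Cod C q)"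
    by (auto simp: is_pullback_def Hom_def)
  show "essential_mono C q"
    by (rule inverted_essential_mono[OF q inverted_pullback[OF m assms(2) u pb]])
qed

text \<open>A pullback \<open>q\<close> of \<open>F m\<close> along \<open>u\<close> is compared with \<open>F n\<close>, where \<open>n\<close> is the pullback of \<open>m\<close>
  along a left lift \<open>v\<close> of \<open>u\<close>; a map \<open>f\<close> with \<open>f q\<close> mono is tested on a right lift of \<open>f\<close>.\<close>

lemma preserves_pullback_stable:
  assumes pbs: "has_pullbacks C" and m: "pullback_stable_essential_mono C m"
  shows "pullback_stable_essential_mono X (Fm m)"
  unfolding pullback_stable_essential_mono_def
proof (intro conjI allI impI)
  have mm: "is_mono C m" using m by (simp add: pullback_stable_essential_mono_def)
  define s a where "s = Dom C m" and "a = Cod C m"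
  have mh: "m \<in> Hom C s a" using mm by (simp add: s_def a_def is_mono_def Hom_def)
  note Fmh = F_hom[OF mh] and Fmm = preserves_mono[OF mh mm]
  show "is_mono X (Fm m)" by (rule Fmm)
  fix u p q assume pb: "is_pullback X (Fm m) u p q"
  define x where "x = Dom X u"
  have u: "u \<in> Hom X x (Fo a)" using pb Fmh by (auto simp: is_pullback_def x_def Hom_def)
  obtain d where p: "p \<in> Hom X d (Fo s)" and q: "q \<in> Hom X d x"
    and U: "\<And>t v w. \<lbrakk>v \<in> Hom X t (Fo s); w \<in> Hom X t x; Fm m \<cdot>\<^bsub>X\<^esub> v = u \<cdot>\<^bsub>X\<^esub> w\<rbrakk>
      \<Longrightarrow> \<exists>h\<in>Hom X t d. p \<cdot>\<^bsub>X\<^esub> h = v \<and> q \<cdot>\<^bsub>X\<^esub> h = w"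
    by (rule X.is_pullbackE[OF pb Fmh u]) (rule that; blast)
  obtain y j where y: "y \<in> Obj C" and j: "j \<in> Hom X (Fo y) x" "is_iso X j"
    and L: "\<And>a w. \<lbrakk>a \<in> Obj C; w \<in> Hom X (Fo y) (Fo a)\<rbrakk> \<Longrightarrow> \<exists>v\<in>Hom C y a. Fm v = w"
    using left_liftE X.Hom_obj(1)[OF u] by metis
  obtain v where v: "v \<in> Hom C y a" "Fm v = u \<cdot>\<^bsub>X\<^esub> j"
    using L[OF C.Hom_obj(2)[OF mh] X.comp_hom[OF j(1) u]] by blast
  obtain p' n where pb': "is_pullback C m v p' n"
    using pbs mh v(1) unfolding has_pullbacks_def by blast
  obtain d' where p': "p' \<in> Hom C d' s" and n: "n \<in> Hom C d' y" and sq: "m \<cdot>\<^bsub>C\<^esub> p' = v \<cdot>\<^bsub>C\<^esub> n"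
    by (rule C.is_pullbackE[OF pb' mh v(1)]) (rule that; blast)
  have ess: "essential_mono C n"
    using m pb' by (simp add: pullback_stable_essential_mono_def)
  have jn: "j \<cdot>\<^bsub>X\<^esub> Fm n \<in> Hom X (Fo d') x" by (rule X.comp_hom[OF F_hom[OF n] j(1)])
  have "Fm m \<cdot>\<^bsub>X\<^esub> Fm p' = u \<cdot>\<^bsub>X\<^esub> (j \<cdot>\<^bsub>X\<^esub> Fm n)"
    using F_comp[OF p' mh] F_comp[OF n v(1)] sq v(2) X.comp_assoc[OF F_hom[OF n] j(1) u] by simp
  \<comment> \<open>The comparison map from the image of the pullback in \<open>C\<close> to the
    pullback in \<open>X\<close>; it is mono because \<open>q\<close> after it is the mono
    \<open>Fm n\<close> followed by the isomorphism \<open>j\<close>.\<close>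
  then obtain t where t: "t \<in> Hom X (Fo d') d" "q \<cdot>\<^bsub>X\<^esub> t = j \<cdot>\<^bsub>X\<^esub> Fm n"
    using U[OF F_hom[OF p'] jn] by blast
  have "is_mono X (Fm n)" using preserves_mono[OF n] ess by (simp add: essential_mono_def)
  then have "is_mono X (q \<cdot>\<^bsub>X\<^esub> t)"
    using t(2) X.mono_comp[OF F_hom[OF n] _ j(1) X.iso_mono[OF j(2)]] by simp
  then have tm: "is_mono X t" using X.mono_cancel[OF t(1) q] by blast
  show "essential_mono X q"
    unfolding essential_mono_def
  proof (intro conjI allI ballI impI)
    show "is_mono X q" by (rule X.pullback_mono[OF pb Fmh Fmm u])
    fix z f assume "f \<in> Hom X (Cod X q) z" and fq: "is_mono X (f \<cdot>\<^bsub>X\<^esub> q)"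
    then have f: "f \<in> Hom X x z" using q by (simp add: Hom_def)
    obtain y' k where k: "k \<in> Hom X z (Fo y')" "is_iso X k"
      and R: "\<And>a w. \<lbrakk>a \<in> Obj C; w \<in> Hom X (Fo a) (Fo y')\<rbrakk> \<Longrightarrow> \<exists>v\<in>Hom C a y'. Fm v = w"
      using right_liftE X.Hom_obj(2)[OF f] by metis
    have fj: "f \<cdot>\<^bsub>X\<^esub> j \<in> Hom X (Fo y) z" by (rule X.comp_hom[OF j(1) f])
    \<comment> \<open>A lift to \<open>C\<close> of \<open>f\<close>, transported along the
      isomorphisms \<open>j\<close> and \<open>k\<close>. The image of \<open>g \<cdot> n\<close> is
      then \<open>f \<cdot> q\<close> with monos \<open>t\<close> and \<open>k\<close> on its two
      sides, so essentiality of \<open>n\<close> applies to \<open>g\<close>.\<close>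
    obtain g where g: "g \<in> Hom C y y'" "Fm g = k \<cdot>\<^bsub>X\<^esub> (f \<cdot>\<^bsub>X\<^esub> j)"
      using R[OF y X.comp_hom[OF fj k(1)]] by blast
    have "Fm (g \<cdot>\<^bsub>C\<^esub> n) = k \<cdot>\<^bsub>X\<^esub> ((f \<cdot>\<^bsub>X\<^esub> j) \<cdot>\<^bsub>X\<^esub> Fm n)"
      using F_comp[OF n g(1)] g(2) X.comp_assoc[OF F_hom[OF n] fj k(1)] by simp
    also have "\<dots> = k \<cdot>\<^bsub>X\<^esub> ((f \<cdot>\<^bsub>X\<^esub> q) \<cdot>\<^bsub>X\<^esub> t)"
      using X.comp_assoc[OF F_hom[OF n] j(1) f] X.comp_assoc[OF t(1) q f] t(2) by simp
    finally have "is_mono X (Fm (g \<cdot>\<^bsub>C\<^esub> n))"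
      using X.mono_comp[OF X.comp_hom[OF t(1) X.comp_hom[OF q f]] _ k(1) X.iso_mono[OF k(2)]]
        X.mono_comp[OF t(1) tm X.comp_hom[OF q f] fq] by simp
    then have "is_mono C (g \<cdot>\<^bsub>C\<^esub> n)" using reflects_mono[OF C.comp_hom[OF n g(1)]] by blast
    moreover have "g \<in> Hom C (Cod C n) y'" using g(1) n by (simp add: Hom_def)
    ultimately have "is_mono C g" using ess unfolding essential_mono_def by blast
    then have "is_mono X (k \<cdot>\<^bsub>X\<^esub> (f \<cdot>\<^bsub>X\<^esub> j))" using preserves_mono[OF g(1)] g(2) by simp
    then show "is_mono X f"
      using X.mono_cancel[OF fj k(1)] X.mono_precomp_iso_cancel[OF j(1) f _ j(2)] by blast
  qed
qed

text \<open>\<open>F\<close> carries the class in \<open>C\<close> into the one in \<open>X\<close>,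
  where only isomorphisms remain by assumption; the converse is
  \<open>inverted_pullback_stable\<close>.\<close>

lemma pullback_stable_iff:
  assumes "has_pullbacks C"
    and "\<And>m. pullback_stable_essential_mono X m \<Longrightarrow> is_iso X m"
  shows "pullback_stable_essential_mono C m \<longleftrightarrow> m \<in> Mor C \<and> is_iso X (Fm m)"
proof
  assume m: "pullback_stable_essential_mono C m"
  then have "m \<in> Mor C" by (simp add: pullback_stable_essential_mono_def is_mono_def)
  then show "m \<in> Mor C \<and> is_iso X (Fm m)"
    using assms(2)[OF preserves_pullback_stable[OF assms(1) m]] by blast
qed (use inverted_pullback_stable in blast)

end

section \<open>Full lifts from adjoints\<close>

lemma comp_func_simps:
  "on_obj (comp_func G F) a = on_obj G (on_obj F a)"
  "on_mor (comp_func G F) f = on_mor G (on_mor F f)"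
  by (simp_all add: comp_func_def)

lemma id_func_simps: "on_obj id_func a = a" "on_mor id_func f = f"
  by (simp_all add: id_func_def)

lemma functorD:
  assumes "is_functor A B F"
  shows "a \<in> Obj A \<Longrightarrow> on_obj F a \<in> Obj B"
    and "f \<in> Hom A a b \<Longrightarrow> on_mor F f \<in> Hom B (on_obj F a) (on_obj F b)"
    and "a \<in> Obj A \<Longrightarrow> on_mor F (Id A a) = Id B (on_obj F a)"
    and "\<lbrakk>f \<in> Hom A a b; g \<in> Hom A b c\<rbrakk>
      \<Longrightarrow> on_mor F (g \<cdot>\<^bsub>A\<^esub> f) = on_mor F g \<cdot>\<^bsub>B\<^esub> on_mor F f"
  using assms unfolding is_functor_def by blast+

lemma adjunctionD:
  assumes "adjunction C X F G \<eta> \<epsilon>"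
  shows "is_functor C X F" "is_functor X C G"
    and "a \<in> Obj C \<Longrightarrow> \<eta> a \<in> Hom C a (on_obj G (on_obj F a))"
    and "x \<in> Obj X \<Longrightarrow> \<epsilon> x \<in> Hom X (on_obj F (on_obj G x)) x"
    and "f \<in> Hom C a b \<Longrightarrow> \<eta> b \<cdot>\<^bsub>C\<^esub> f = on_mor G (on_mor F f) \<cdot>\<^bsub>C\<^esub> \<eta> a"
    and "w \<in> Hom X x y \<Longrightarrow> \<epsilon> y \<cdot>\<^bsub>X\<^esub> on_mor F (on_mor G w) = w \<cdot>\<^bsub>X\<^esub> \<epsilon> x"
    and "a \<in> Obj C \<Longrightarrow> \<epsilon> (on_obj F a) \<cdot>\<^bsub>X\<^esub> on_mor F (\<eta> a) = Id X (on_obj F a)"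
    and "x \<in> Obj X \<Longrightarrow> on_mor G (\<epsilon> x) \<cdot>\<^bsub>C\<^esub> \<eta> (on_obj G x) = Id C (on_obj G x)"
  using assms unfolding adjunction_def nat_trans_def comp_func_simps id_func_simps by blast+

text \<open>The lift of \<open>x\<close> is \<open>on_obj G x\<close> with the counit, which is
  invertible because \<open>G\<close> is fully faithful; maps lift by transposition.\<close>

lemma right_adjoint_full_lifts:
  assumes adj: "adjunction C X F G \<eta> \<epsilon>" and full: "full X C G" and faithful: "faithful X G"
  shows "has_full_lifts C X F"
  unfolding has_full_lifts_def
proof
  note A = adjunctionD[OF adj]
  interpret C: category C using A(1) by (simp add: is_functor_def)
  interpret X: category X using A(1) by (simp add: is_functor_def)
  note Fm = functorD(2)[OF A(1)] and Gm = functorD(2)[OF A(2)]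
  fix x assume x: "x \<in> Obj X"
  define y where "y = on_obj G x"
  have y: "y \<in> Obj C" unfolding y_def by (rule functorD(1)[OF A(2) x])
  have e: "\<epsilon> x \<in> Hom X (on_obj F y) x" unfolding y_def by (rule A(4)[OF x])
  have Fy: "on_obj F y \<in> Obj X" by (rule functorD(1)[OF A(1) y])
  \<comment> \<open>The inverse of the counit is the preimage under \<open>G\<close> of the unit at
    \<open>y\<close>. One composite is the identity by a triangle identity and faithfulness of
    \<open>G\<close>, the other by naturality of \<epsilon> at \<open>t\<close> and the other
    triangle identity.\<close>
  obtain t where t: "t \<in> Hom X x (on_obj F y)" "on_mor G t = \<eta> y"
    using full x Fy A(3)[OF y] unfolding full_def y_def by blast
  have et: "\<epsilon> x \<cdot>\<^bsub>X\<^esub> t \<in> Hom X x x" by (rule X.comp_hom[OF t(1) e])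
  have "on_mor G (\<epsilon> x \<cdot>\<^bsub>X\<^esub> t) = on_mor G (Id X x)"
    using functorD(4)[OF A(2) t(1) e] t(2) A(8)[OF x] functorD(3)[OF A(2) x] by (simp add: y_def)
  then have et_id: "\<epsilon> x \<cdot>\<^bsub>X\<^esub> t = Id X x"
    using faithful et X.id_hom[OF x] x unfolding faithful_def by blast
  have "t \<cdot>\<^bsub>X\<^esub> \<epsilon> x = Id X (on_obj F y)"
    using A(6)[OF t(1)] t(2) A(7)[OF y] by (simp add: y_def)
  then have iso: "is_iso X (\<epsilon> x)" using is_isoI[OF e t(1)] et_id by blast
  have lift: "\<exists>v\<in>Hom C a y. on_mor F v = w"
    if w: "w \<in> Hom X (on_obj F a) (on_obj F y)" and a: "a \<in> Obj C" for a w
  proof -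
    have ew: "\<epsilon> x \<cdot>\<^bsub>X\<^esub> w \<in> Hom X (on_obj F a) x" by (rule X.comp_hom[OF w e])
    note Gew = Gm[OF ew] and v = C.comp_hom[OF A(3)[OF a] Gm[OF ew]]
    \<comment> \<open>The transpose of \<open>\<epsilon> x \<cdot> w\<close>. That its image is
      \<open>w\<close> is checked after composing with the counit, which is mono.\<close>
    let ?v = "on_mor G (\<epsilon> x \<cdot>\<^bsub>X\<^esub> w) \<cdot>\<^bsub>C\<^esub> \<eta> a"
    note Fa = functorD(1)[OF A(1) a]
    have "\<epsilon> x \<cdot>\<^bsub>X\<^esub> on_mor F ?v = (\<epsilon> x \<cdot>\<^bsub>X\<^esub> on_mor F (on_mor G (\<epsilon> x \<cdot>\<^bsub>X\<^esub> w))) \<cdot>\<^bsub>X\<^esub> on_mor F (\<eta> a)"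
      using functorD(4)[OF A(1) A(3)[OF a] Gew] X.comp_assoc[OF Fm[OF A(3)[OF a]] Fm[OF Gew] A(4)[OF x]]
      by simp
    also have "\<dots> = (\<epsilon> x \<cdot>\<^bsub>X\<^esub> w) \<cdot>\<^bsub>X\<^esub> (\<epsilon> (on_obj F a) \<cdot>\<^bsub>X\<^esub> on_mor F (\<eta> a))"
      using A(6)[OF ew] X.comp_assoc[OF Fm[OF A(3)[OF a]] A(4)[OF Fa] ew] by simp
    also have "\<dots> = \<epsilon> x \<cdot>\<^bsub>X\<^esub> w" using A(7)[OF a] X.id_right[OF ew] by simp
    finally have "on_mor F ?v = w"
      using is_monoD[OF X.iso_mono[OF iso] e Fm[OF v, folded y_def] w] by blast
    then show ?thesis using v unfolding y_def by blast
  qed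
  show "\<exists>y\<in>Obj C. \<exists>e\<in>Hom X (on_obj F y) x. is_iso X e \<and>
      (\<forall>a. \<forall>w\<in>Hom X (on_obj F a) (on_obj F y). a \<in> Obj C \<longrightarrow> (\<exists>v\<in>Hom C a y. on_mor F v = w))"
    using y e iso lift by (intro bexI[of _ y] bexI[of _ "\<epsilon> x"]) simp_all
qed

text \<open>If one adjoint of \<open>F\<close> is fully faithful then so is the other: the unit of the left adjoint is
  invertible because it is so when tested on maps into the lifted objects.\<close>

lemma left_adjoint_full_lifts:
  assumes adj: "adjunction X C H F \<eta> \<epsilon>" and lifts: "has_full_lifts C X F"
  shows "has_full_lifts (opp C) (opp X) F"
  unfolding has_full_lifts_def opp_simps Hom_opp is_iso_opp
proof
  note A = adjunctionD[OF adj]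
  interpret C: category C using A(1) by (simp add: is_functor_def)
  interpret X: category X using A(1) by (simp add: is_functor_def)
  note Fm = functorD(2)[OF A(2)] and Hm = functorD(2)[OF A(1)]
  fix x assume x: "x \<in> Obj X"
  define y where "y = on_obj H x"
  have y: "y \<in> Obj C" unfolding y_def by (rule functorD(1)[OF A(1) x])
  have n: "\<eta> x \<in> Hom X x (on_obj F y)" unfolding y_def by (rule A(3)[OF x])
  have Fy: "on_obj F y \<in> Obj X" by (rule functorD(1)[OF A(2) y])
  \<comment> \<open>Existence half of the universal property of the unit.\<close>
  have ex: "\<exists>v\<in>Hom C y a. on_mor F v \<cdot>\<^bsub>X\<^esub> \<eta> x = w"
    if a: "a \<in> Obj C" and w: "w \<in> Hom X x (on_obj F a)" for a w
  proof
    have Ha: "\<epsilon> a \<in> Hom C (on_obj H (on_obj F a)) a" by (rule A(4)[OF a])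
    note Hw = Hm[OF w, folded y_def]
    show "\<epsilon> a \<cdot>\<^bsub>C\<^esub> on_mor H w \<in> Hom C y a" by (rule C.comp_hom[OF Hw Ha])
    have "on_mor F (\<epsilon> a \<cdot>\<^bsub>C\<^esub> on_mor H w) \<cdot>\<^bsub>X\<^esub> \<eta> x
        = on_mor F (\<epsilon> a) \<cdot>\<^bsub>X\<^esub> (on_mor F (on_mor H w) \<cdot>\<^bsub>X\<^esub> \<eta> x)"
      using functorD(4)[OF A(2) Hw Ha] X.comp_assoc[OF n Fm[OF Hw] Fm[OF Ha]] by simp
    also have "\<dots> = (on_mor F (\<epsilon> a) \<cdot>\<^bsub>X\<^esub> \<eta> (on_obj F a)) \<cdot>\<^bsub>X\<^esub> w"
      using A(5)[OF w] X.comp_assoc[OF w A(3) Fm[OF Ha]] functorD(1)[OF A(2) a] by simp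
    finally show "on_mor F (\<epsilon> a \<cdot>\<^bsub>C\<^esub> on_mor H w) \<cdot>\<^bsub>X\<^esub> \<eta> x = w"
      using A(8)[OF a] X.id_left[OF w] by simp
  qed
  \<comment> \<open>Uniqueness half: \<open>v\<close> is recovered from its transpose by transposing
    back.\<close>
  have transpose: "\<epsilon> a \<cdot>\<^bsub>C\<^esub> on_mor H (on_mor F v \<cdot>\<^bsub>X\<^esub> \<eta> x) = v" if v: "v \<in> Hom C y a" for v a
  proof -
    have a: "a \<in> Obj C" using C.Hom_obj v by blast
    note Hn = Hm[OF n, folded y_def] and Ha = A(4)[OF a] and Hv = Hm[OF Fm[OF v]]
    have "\<epsilon> a \<cdot>\<^bsub>C\<^esub> on_mor H (on_mor F v \<cdot>\<^bsub>X\<^esub> \<eta> x)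
        = (\<epsilon> a \<cdot>\<^bsub>C\<^esub> on_mor H (on_mor F v)) \<cdot>\<^bsub>C\<^esub> on_mor H (\<eta> x)"
      using functorD(4)[OF A(1) n Fm[OF v]] C.comp_assoc[OF Hn Hv Ha] by simp
    also have "\<dots> = v \<cdot>\<^bsub>C\<^esub> (\<epsilon> y \<cdot>\<^bsub>C\<^esub> on_mor H (\<eta> x))"
      using A(6)[OF v] C.comp_assoc[OF Hn A(4)[OF y] v] by simp
    finally show ?thesis using A(7)[OF x] C.id_right[OF v] by (simp add: y_def)
  qed
  \<comment> \<open>A retraction \<open>r\<close> of the unit: the inverse \<open>d\<close> of
    \<open>e\<close> is a map from \<open>x\<close> to an object in the image of \<open>F\<close>,
    so it factors through \<open>\<eta> x\<close>, and composing the factor with \<open>e\<close>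
    gives \<open>r\<close>.\<close>
  obtain z e where z: "z \<in> Obj C" and e: "e \<in> Hom X (on_obj F z) x" "is_iso X e"
    by (rule has_full_liftsE[OF lifts x]) (rule that; blast)
  obtain d where d: "d \<in> Hom X x (on_obj F z)" "e \<cdot>\<^bsub>X\<^esub> d = Id X x" using is_isoE[OF e(2,1)] by metis
  obtain k where k: "k \<in> Hom C y z" "on_mor F k \<cdot>\<^bsub>X\<^esub> \<eta> x = d" using ex[OF z d(1)] by blast
  define r where "r = e \<cdot>\<^bsub>X\<^esub> on_mor F k"
  have r: "r \<in> Hom X (on_obj F y) x" unfolding r_def by (rule X.comp_hom[OF Fm[OF k(1)] e(1)])
  have rn: "r \<cdot>\<^bsub>X\<^esub> \<eta> x = Id X x"
    using X.comp_assoc[OF n Fm[OF k(1)] e(1)] k(2) d(2) by (simp add: r_def)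
  have nr: "\<eta> x \<cdot>\<^bsub>X\<^esub> r \<in> Hom X (on_obj F y) (on_obj F y)" by (rule X.comp_hom[OF r n])
  \<comment> \<open>To see that \<open>r\<close> is also a section, the endomorphism
    \<open>\<eta> x \<cdot> r\<close> is compared with the identity after \<open>d'\<close>. Both
    composites then lift to \<open>C\<close>, and the lifts agree because they have the same
    transpose.\<close>
  obtain z' e' where z': "z' \<in> Obj C" and e': "e' \<in> Hom X (on_obj F z') (on_obj F y)" "is_iso X e'"
    and L: "\<And>a w. \<lbrakk>a \<in> Obj C; w \<in> Hom X (on_obj F a) (on_obj F z')\<rbrakk> \<Longrightarrow> \<exists>v\<in>Hom C a z'. on_mor F v = w"
    by (rule has_full_liftsE[OF lifts Fy]) (rule that; blast)
  obtain d' where d': "d' \<in> Hom X (on_obj F y) (on_obj F z')" "e' \<cdot>\<^bsub>X\<^esub> d' = Id X (on_obj F y)"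
    using is_isoE[OF e'(2,1)] by metis
  obtain v where v: "v \<in> Hom C y z'" "on_mor F v = d' \<cdot>\<^bsub>X\<^esub> (\<eta> x \<cdot>\<^bsub>X\<^esub> r)"
    using L[OF y X.comp_hom[OF nr d'(1)]] by blast
  obtain v' where v': "v' \<in> Hom C y z'" "on_mor F v' = d'" using L[OF y d'(1)] by blast
  have "on_mor F v \<cdot>\<^bsub>X\<^esub> \<eta> x = d' \<cdot>\<^bsub>X\<^esub> (\<eta> x \<cdot>\<^bsub>X\<^esub> (r \<cdot>\<^bsub>X\<^esub> \<eta> x))"
    using v(2) X.comp_assoc[OF n nr d'(1)] X.comp_assoc[OF n r n] by simp
  also have "\<dots> = on_mor F v' \<cdot>\<^bsub>X\<^esub> \<eta> x" using rn X.id_right[OF n] v'(2) by simp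
  finally have eq: "on_mor F v \<cdot>\<^bsub>X\<^esub> \<eta> x = on_mor F v' \<cdot>\<^bsub>X\<^esub> \<eta> x" .
  have "v = v'" by (rule trans[OF transpose[OF v(1), unfolded eq, symmetric] transpose[OF v'(1)]])
  then have "d' \<cdot>\<^bsub>X\<^esub> (\<eta> x \<cdot>\<^bsub>X\<^esub> r) = d'" using v(2) v'(2) by simp
  then have nr_id: "\<eta> x \<cdot>\<^bsub>X\<^esub> r = Id X (on_obj F y)"
    using X.retraction_cancel[OF d'(1) e'(1) d'(2) nr] d'(2) by simp
  then have iso: "is_iso X (\<eta> x)" using is_isoI[OF n r rn] by blast
  have lift: "\<exists>v\<in>Hom C y a. on_mor F v = w"
    if w: "w \<in> Hom X (on_obj F y) (on_obj F a)" and a: "a \<in> Obj C" for a w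
  proof -
    obtain v where v: "v \<in> Hom C y a" "on_mor F v \<cdot>\<^bsub>X\<^esub> \<eta> x = w \<cdot>\<^bsub>X\<^esub> \<eta> x"
      using ex[OF a X.comp_hom[OF n w]] by blast
    have "on_mor F v = w"
      using X.section_cancel[OF n r nr_id w] X.section_cancel[OF n r nr_id Fm[OF v(1)]] v(2) by simp
    then show ?thesis using v(1) by blast
  qed
  show "\<exists>y\<in>Obj C. \<exists>e\<in>Hom X x (on_obj F y). is_iso X e \<and>
      (\<forall>a. \<forall>w\<in>Hom X (on_obj F y) (on_obj F a). a \<in> Obj C \<longrightarrow> (\<exists>v\<in>Hom C y a. on_mor F v = w))"
    using y n iso lift by (intro bexI[of _ y] bexI[of _ "\<eta> x"]) simp_all
qed

text \<open>Full faithfulness of \<open>G\<close> supplies the right lifts, and from these the left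
  adjoint of \<open>F\<close> obtains the left lifts.\<close>

lemma essential_localization_bilift:
  assumes "essential_localization C X F G \<eta> \<epsilon>" and "faithful C F"
  shows "faithful_bilift C X F"
proof -
  have adj: "adjunction C X F G \<eta> \<epsilon>" and G: "full X C G" "faithful X G"
    and H: "has_left_adjoint C X F"
    using assms(1) by (auto simp: essential_localization_def localization_def)
  note F = adjunctionD(1)[OF adj]
  note R = right_adjoint_full_lifts[OF adj G]
  from H obtain H \<eta>' \<epsilon>' where "adjunction X C H F \<eta>' \<epsilon>'" by (auto simp: has_left_adjoint_def)
  then have "has_full_lifts (opp C) (opp X) F" using R by (rule left_adjoint_full_lifts)
  then show ?thesis
    using F R assms(2)
    by (intro faithful_bilift.intro faithful_bilift_axioms.intro) (simp_all add: is_functor_def)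
qed

section \<open>Categories of fractions\<close>

lemma is_functor_id: "category A \<Longrightarrow> is_functor A A id_func"
  by (simp add: is_functor_def id_func_simps)

lemma is_functor_comp:
  assumes "is_functor A B F" "is_functor B D G"
  shows "is_functor A D (comp_func G F)"
proof -
  note F = functorD[OF assms(1)] and G = functorD[OF assms(2)]
  have "category A" "category D" using assms by (simp_all add: is_functor_def)
  moreover have "on_mor G (on_mor F (g \<cdot>\<^bsub>A\<^esub> f)) = on_mor G (on_mor F g) \<cdot>\<^bsub>D\<^esub> on_mor G (on_mor F f)"
    if "f \<in> Hom A a b" "g \<in> Hom A b c" for a b c f g
    using F(4)[OF that] G(4)[OF F(2)[OF that(1)] F(2)[OF that(2)]] by simp
  ultimately show ?thesis
    using F(1-3) G(1-3) unfolding is_functor_def comp_func_simps by auto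
qed

section \<open>Naturality over zigzags\<close>

context category
begin

lemma square_paste:
  assumes p: "p \<in> Hom C a b" "p' \<in> Hom C b c" and q: "q \<in> Hom C a' b'" "q' \<in> Hom C b' c'"
    and t: "ta \<in> Hom C a a'" "tb \<in> Hom C b b'" "tc \<in> Hom C c c'"
    and sq: "tb \<cdot> p = q \<cdot> ta" "tc \<cdot> p' = q' \<cdot> tb"
  shows "tc \<cdot> (p' \<cdot> p) = (q' \<cdot> q) \<cdot> ta"
  using comp_assoc[OF p t(3)] comp_assoc[OF p(1) t(2) q(2)] comp_assoc[OF t(1) q] sq by simp

text \<open>Naturality at a morphism gives naturality at its inverse: write \<open>tb\<close> as
  \<open>q \<cdot> ta \<cdot> p'\<close> and cancel \<open>q\<close>.\<close>

lemma square_invert: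
  assumes p: "p \<in> Hom C a b" "p' \<in> Hom C b a" "p \<cdot> p' = Id C b"
    and q: "q \<in> Hom C a' b'" "q' \<in> Hom C b' a'" "q' \<cdot> q = Id C a'"
    and t: "ta \<in> Hom C a a'" "tb \<in> Hom C b b'" and sq: "tb \<cdot> p = q \<cdot> ta"
  shows "ta \<cdot> p' = q' \<cdot> tb"
proof -
  have "tb = (q \<cdot> ta) \<cdot> p'" using section_cancel[OF p(1,2,3) t(2)] sq by simp
  also have "\<dots> = q \<cdot> (ta \<cdot> p')" using comp_assoc[OF p(2) t(1) q(1)] by simp
  finally show ?thesis using retraction_cancel[OF q comp_hom[OF p(2) t(1)]] by simp
qed

end

text \<open>Naturality squares paste along composites and can be inverted, so checking them on the
  morphisms coming from \<open>C\<close> is enough.\<close>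

lemma nat_trans_fractions:
  assumes C: "category C" and P: "is_functor (fractions C S) B P" and Q: "is_functor (fractions C S) B Q"
    and t: "\<And>a. a \<in> Obj C \<Longrightarrow> \<tau> a \<in> Hom B (on_obj P a) (on_obj Q a)"
    and nat: "\<And>a b f. f \<in> Hom C a b \<Longrightarrow> \<tau> b \<cdot>\<^bsub>B\<^esub> on_mor P (frac C S a [Fwd f] b)
      = on_mor Q (frac C S a [Fwd f] b) \<cdot>\<^bsub>B\<^esub> \<tau> a"
  shows "nat_trans (fractions C S) B P Q \<tau>"
proof -
  interpret B: category B using P by (simp add: is_functor_def)
  have main: "zigzag C S a p b \<Longrightarrow> \<tau> b \<cdot>\<^bsub>B\<^esub> on_mor P (frac C S a p b)
      = on_mor Q (frac C S a p b) \<cdot>\<^bsub>B\<^esub> \<tau> a" for a p b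
  proof (induction p arbitrary: a)
    case Nil
    then have ab: "b = a" and a: "a \<in> Obj C" by auto
    then show ?case
      using functorD(3)[OF P, of a] functorD(3)[OF Q, of a] B.id_right[OF t[OF a]] B.id_left[OF t[OF a]]
      by (simp add: fractions_simps)
  next
    case (Cons s p)
    have paste: "\<tau> b \<cdot>\<^bsub>B\<^esub> on_mor P (frac C S a (s # p) b)
        = on_mor Q (frac C S a (s # p) b) \<cdot>\<^bsub>B\<^esub> \<tau> a"
      if s: "zigzag C S a [s] c" and p: "zigzag C S c p b"
        and sq: "\<tau> c \<cdot>\<^bsub>B\<^esub> on_mor P (frac C S a [s] c) = on_mor Q (frac C S a [s] c) \<cdot>\<^bsub>B\<^esub> \<tau> a" for c
    proof -
      note fs = frac_hom[OF s] and fp = frac_hom[OF p]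
      have obj: "a \<in> Obj C" "c \<in> Obj C" "b \<in> Obj C"
        using zigzag_ends[OF C s] zigzag_ends[OF C p] by auto
      have "frac C S a (s # p) b = frac C S c p b \<cdot>\<^bsub>fractions C S\<^esub> frac C S a [s] c"
        using frac_comp[OF s p] by simp
      then show ?thesis
        using B.square_paste[OF functorD(2)[OF P fs] functorD(2)[OF P fp] functorD(2)[OF Q fs]
            functorD(2)[OF Q fp] t[OF obj(1)] t[OF obj(2)] t[OF obj(3)] sq Cons.IH[OF p]]
          functorD(4)[OF P fs fp] functorD(4)[OF Q fs fp] by simp
    qed
    show ?case
    proof (cases s)
      case (Fwd f)
      with Cons.prems have f: "f \<in> Hom C a (Cod C f)" and p: "zigzag C S (Cod C f) p b"
        by (auto simp: Hom_def)
      show ?thesis using paste[OF _ p] zigzag_Fwd[OF C f] nat[OF f] Fwd by simp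
    next
      case (Bwd m)
      define c where "c = Dom C m"
      from Bwd Cons.prems have m: "m \<in> S" "m \<in> Hom C c a" and p: "zigzag C S c p b"
        by (auto simp: Hom_def c_def)
      note zF = zigzag_Fwd[where S = S, OF C m(2)] and zB = zigzag_Bwd[where S = S, OF C m]
      note fF = frac_hom[OF zF] and fB = frac_hom[OF zB]
      have obj: "a \<in> Obj C" "c \<in> Obj C" using zigzag_ends[OF C zF] by auto
      \<comment> \<open>Inverting the square uses a right inverse for the image of \<open>m\<close>
        under \<open>P\<close> and a left inverse for its image under \<open>Q\<close>; the two
        cancellation rules for zigzags provide these.\<close>
      have "frac C S c [Fwd m] a \<cdot>\<^bsub>fractions C S\<^esub> frac C S a [Bwd m] c = Id (fractions C S) a"
        using frac_comp[OF zB zF] frac_eq_iff[of C S a "[]" a] zz_bwd_fwd[OF m] obj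
        by (simp add: fractions_simps)
      then have 1: "on_mor P (frac C S c [Fwd m] a) \<cdot>\<^bsub>B\<^esub> on_mor P (frac C S a [Bwd m] c)
          = Id B (on_obj P a)"
        using functorD(4)[OF P fB fF] functorD(3)[OF P, of a] obj by (simp add: fractions_simps)
      have "frac C S a [Bwd m] c \<cdot>\<^bsub>fractions C S\<^esub> frac C S c [Fwd m] a = Id (fractions C S) c"
        using frac_comp[OF zF zB] frac_eq_iff[of C S c "[]" c] zz_fwd_bwd[OF m] obj
        by (simp add: fractions_simps)
      then have 2: "on_mor Q (frac C S a [Bwd m] c) \<cdot>\<^bsub>B\<^esub> on_mor Q (frac C S c [Fwd m] a)
          = Id B (on_obj Q c)"
        using functorD(4)[OF Q fF fB] functorD(3)[OF Q, of c] obj by (simp add: fractions_simps)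
      have "zigzag C S a [s] c" using zB unfolding Bwd .
      from paste[OF this p] show ?thesis
        using Bwd B.square_invert[OF functorD(2)[OF P fF] functorD(2)[OF P fB] 1
            functorD(2)[OF Q fF] functorD(2)[OF Q fB] 2 t[OF obj(2)] t[OF obj(1)] nat[OF m(2)]]
        by simp
    qed
  qed
  show ?thesis
    unfolding nat_trans_def
    using P Q t main by (auto simp: fractions_simps Hom_fractions)
qed

text \<open>The inverse equivalence is the canonical functor after the right adjoint of \<open>F\<close>, rebuilt here
  from chosen lifts.\<close>

lemma fractions_equivalent:
  assumes F: "is_functor C X F" and faithful: "faithful C F" and lifts: "has_full_lifts C X F"
    and S: "\<And>m. m \<in> S \<longleftrightarrow> m \<in> Mor C \<and> is_iso X (on_mor F m)"
  shows "equivalent_categories (fractions C S) X"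
proof -
  interpret C: category C using F by (simp add: is_functor_def)
  interpret X: category X using F by (simp add: is_functor_def)
  note catF = category_fractions[OF C.category_axioms, of S]
  note toF = is_functor_to_fractions[OF C.category_axioms, of S]
  note Fo = functorD(1)[OF F] and Fm = functorD(2)[OF F] and Fc = functorD(4)[OF F]
  have F_inj: "f = g" if "f \<in> Hom C a b" "g \<in> Hom C a b" "on_mor F f = on_mor F g" for f g a b
    using faithful that C.Hom_obj[OF that(1)] unfolding faithful_def by blast
  obtain K where K: "is_functor (fractions C S) X K" "func_eq C (comp_func K (to_fractions C S)) F"
    using fractions_universal[of C X F S] F S by blast
  have Ko: "on_obj K a = on_obj F a" if "a \<in> Obj C" for a
    using K(2) that by (simp add: func_eq_def comp_func_simps to_fractions_def)
  have Km: "on_mor K (frac C S a [Fwd f] b) = on_mor F f" if "f \<in> Hom C a b" for f a b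
    using K(2) that on_mor_to_fractions[OF that, of S]
    by (auto simp: func_eq_def comp_func_simps Hom_def)
  \<comment> \<open>Object and isomorphism are chosen together as a pair, so that they belong to
    each other.\<close>
  have "\<forall>x\<in>Obj X. \<exists>ye. fst ye \<in> Obj C \<and> snd ye \<in> Hom X (on_obj F (fst ye)) x \<and> is_iso X (snd ye) \<and>
        (\<forall>a. \<forall>w\<in>Hom X (on_obj F a) (on_obj F (fst ye)). a \<in> Obj C \<longrightarrow>
          (\<exists>v\<in>Hom C a (fst ye). on_mor F v = w))"
    using lifts unfolding has_full_lifts_def by fastforce
  from bchoice[OF this] obtain ye where ye: "\<And>x. x \<in> Obj X \<Longrightarrow> fst (ye x) \<in> Obj C \<and>
      snd (ye x) \<in> Hom X (on_obj F (fst (ye x))) x \<and> is_iso X (snd (ye x)) \<and>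
        (\<forall>a. \<forall>w\<in>Hom X (on_obj F a) (on_obj F (fst (ye x))). a \<in> Obj C \<longrightarrow>
          (\<exists>v\<in>Hom C a (fst (ye x)). on_mor F v = w))"
    by blast
  define y e where "y = (\<lambda>x. fst (ye x))" and "e = (\<lambda>x. snd (ye x))"
  have y: "y x \<in> Obj C" and e: "e x \<in> Hom X (on_obj F (y x)) x" and e_iso: "is_iso X (e x)"
    if "x \<in> Obj X" for x
    using ye[OF that] by (simp_all add: y_def e_def)
  \<comment> \<open>With \<open>lift_unique\<close> this makes \<open>e x\<close> a universal arrow
    from \<open>F\<close> to \<open>x\<close>, which is all that is used of a right adjoint
    below.\<close>
  have lift: "\<exists>v\<in>Hom C a (y x). e x \<cdot>\<^bsub>X\<^esub> on_mor F v = w"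
    if x: "x \<in> Obj X" and a: "a \<in> Obj C" and w: "w \<in> Hom X (on_obj F a) x" for x a w
  proof -
    obtain d where d: "d \<in> Hom X x (on_obj F (y x))" "e x \<cdot>\<^bsub>X\<^esub> d = Id X x"
      using is_isoE[OF e_iso[OF x] e[OF x]] by metis
    obtain v where v: "v \<in> Hom C a (y x)" "on_mor F v = d \<cdot>\<^bsub>X\<^esub> w"
      using ye[OF x] X.comp_hom[OF w d(1)] a unfolding y_def by blast
    then show ?thesis using X.retraction_cancel[OF d(1) e[OF x] d(2) w] by (intro bexI[of _ v]) simp_all
  qed
  have lift_unique: "v = v'" if x: "x \<in> Obj X" and v: "v \<in> Hom C a (y x)" "v' \<in> Hom C a (y x)"
    and eq: "e x \<cdot>\<^bsub>X\<^esub> on_mor F v = e x \<cdot>\<^bsub>X\<^esub> on_mor F v'" for x a v v'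
    using is_monoD[OF X.iso_mono[OF e_iso[OF x]] e[OF x] Fm[OF v(1)] Fm[OF v(2)] eq] F_inj[OF v] by blast
  \<comment> \<open>The right adjoint on morphisms, defined so that \<open>e\<close> is natural by
    construction.\<close>
  have "\<forall>w\<in>Mor X. \<exists>v. v \<in> Hom C (y (Dom X w)) (y (Cod X w)) \<and>
      e (Cod X w) \<cdot>\<^bsub>X\<^esub> on_mor F v = w \<cdot>\<^bsub>X\<^esub> e (Dom X w)"
  proof
    fix w assume w: "w \<in> Mor X"
    note x = X.dom_obj[OF w] X.cod_obj[OF w]
    show "\<exists>v. v \<in> Hom C (y (Dom X w)) (y (Cod X w)) \<and>
        e (Cod X w) \<cdot>\<^bsub>X\<^esub> on_mor F v = w \<cdot>\<^bsub>X\<^esub> e (Dom X w)"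
      using lift[OF x(2) y[OF x(1)] X.comp_hom[OF e[OF x(1)] Hom_morI[OF w]]] by blast
  qed
  from bchoice[OF this] obtain l where l: "\<And>w. w \<in> Mor X \<Longrightarrow> l w \<in> Hom C (y (Dom X w)) (y (Cod X w)) \<and>
      e (Cod X w) \<cdot>\<^bsub>X\<^esub> on_mor F (l w) = w \<cdot>\<^bsub>X\<^esub> e (Dom X w)"
    by blast
  have l_hom: "l w \<in> Hom C (y x) (y x')" and l_nat: "e x' \<cdot>\<^bsub>X\<^esub> on_mor F (l w) = w \<cdot>\<^bsub>X\<^esub> e x"
    if "w \<in> Hom X x x'" for w x x'
    using l[of w] that by (auto simp: Hom_def)
  define G where "G = \<lparr>on_obj = y, on_mor = l\<rparr>"
  have G: "is_functor X C G"
    unfolding is_functor_def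
  proof (intro conjI ballI allI)
    show "on_mor G (Id X x) = Id C (on_obj G x)" if x: "x \<in> Obj X" for x
    proof -
      have "e x \<cdot>\<^bsub>X\<^esub> on_mor F (l (Id X x)) = e x \<cdot>\<^bsub>X\<^esub> on_mor F (Id C (y x))"
        using l_nat[OF X.id_hom[OF x]] X.id_left[OF e[OF x]] X.id_right[OF e[OF x]]
          functorD(3)[OF F y[OF x]] by simp
      then show ?thesis
        using lift_unique[OF x l_hom[OF X.id_hom[OF x]] C.id_hom[OF y[OF x]]] by (simp add: G_def)
    qed
    show "on_mor G (g \<cdot>\<^bsub>X\<^esub> f) = on_mor G g \<cdot>\<^bsub>C\<^esub> on_mor G f"
      if f: "f \<in> Hom X a b" and g: "g \<in> Hom X b c" for a b c f g
    proof -
      note obj = X.Hom_obj[OF f] X.Hom_obj[OF g] and gf = X.comp_hom[OF f g]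
      note lgf = C.comp_hom[OF l_hom[OF f] l_hom[OF g]]
      have "e c \<cdot>\<^bsub>X\<^esub> on_mor F (l g \<cdot>\<^bsub>C\<^esub> l f) = (g \<cdot>\<^bsub>X\<^esub> f) \<cdot>\<^bsub>X\<^esub> e a"
        using X.square_paste[OF Fm[OF l_hom[OF f]] Fm[OF l_hom[OF g]] f g e[OF obj(1)] e[OF obj(2)]
            e[OF obj(4)] l_nat[OF f] l_nat[OF g]] Fc[OF l_hom[OF f] l_hom[OF g]] by simp
      then show ?thesis
        using lift_unique[OF obj(4) l_hom[OF gf] lgf] l_nat[OF gf] by (simp add: G_def)
    qed
  qed (use y l_hom C.category_axioms X.category_axioms in \<open>auto simp: G_def\<close>)
  define L where "L = comp_func (to_fractions C S) G"
  have L: "is_functor X (fractions C S) L" unfolding L_def by (rule is_functor_comp[OF G toF])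
  have Lo: "on_obj L x = y x" for x by (simp add: L_def comp_func_simps G_def to_fractions_def)
  have Lm: "on_mor L w = frac C S (y a) [Fwd (l w)] (y b)" if "w \<in> Hom X a b" for w a b
    using on_mor_to_fractions[OF l_hom[OF that]] by (simp add: L_def comp_func_simps G_def)
  have counit: "nat_iso X X (comp_func K L) id_func e"
    unfolding nat_iso_def nat_trans_def
  proof (intro conjI ballI allI)
    show "is_functor X X (comp_func K L)" by (rule is_functor_comp[OF L K(1)])
    show "is_functor X X id_func" by (rule is_functor_id[OF X.category_axioms])
    show "e a \<in> Hom X (on_obj (comp_func K L) a) (on_obj id_func a)" "is_iso X (e a)"
      if "a \<in> Obj X" for a
      using that e e_iso y by (simp_all add: comp_func_simps id_func_simps Lo Ko)
    show "e b \<cdot>\<^bsub>X\<^esub> on_mor (comp_func K L) f = on_mor id_func f \<cdot>\<^bsub>X\<^esub> e a"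
      if "f \<in> Hom X a b" for a b f
      using l_nat[OF that] Km[OF l_hom[OF that]] Lm[OF that] by (simp add: comp_func_simps id_func_simps)
  qed
  \<comment> \<open>The unit at \<open>a\<close> is the lift of the identity of
    \<open>on_obj F a\<close>.\<close>
  have "\<forall>a\<in>Obj C. \<exists>v. v \<in> Hom C a (y (on_obj F a)) \<and> e (on_obj F a) \<cdot>\<^bsub>X\<^esub> on_mor F v = Id X (on_obj F a)"
    using lift Fo X.id_hom by blast
  from bchoice[OF this] obtain u where u: "\<And>a. a \<in> Obj C \<Longrightarrow> u a \<in> Hom C a (y (on_obj F a))"
    and eu: "\<And>a. a \<in> Obj C \<Longrightarrow> e (on_obj F a) \<cdot>\<^bsub>X\<^esub> on_mor F (u a) = Id X (on_obj F a)"
    by blast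
  \<comment> \<open>The image of \<open>u a\<close> under \<open>F\<close> is the inverse of
    \<open>e (on_obj F a)\<close>; hence the unit becomes invertible in the category of
    fractions.\<close>
  have uS: "u a \<in> S" if a: "a \<in> Obj C" for a
  proof -
    note Fa = Fo[OF a]
    obtain d where d: "d \<in> Hom X (on_obj F a) (on_obj F (y (on_obj F a)))"
      "d \<cdot>\<^bsub>X\<^esub> e (on_obj F a) = Id X (on_obj F (y (on_obj F a)))" "e (on_obj F a) \<cdot>\<^bsub>X\<^esub> d = Id X (on_obj F a)"
      using is_isoE[OF e_iso[OF Fa] e[OF Fa]] by metis
    have "on_mor F (u a) = d"
      using is_monoD[OF X.iso_mono[OF e_iso[OF Fa]] e[OF Fa] Fm[OF u[OF a]] d(1)] eu[OF a] d(3) by simp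
    then show ?thesis using X.iso_inverse[OF e[OF Fa] d] u[OF a] S by (simp add: Hom_def)
  qed
  define \<alpha> where "\<alpha> = (\<lambda>a. frac C S a [Fwd (u a)] (y (on_obj F a)))"
  have \<alpha>: "\<alpha> a = on_mor (to_fractions C S) (u a)" if "a \<in> Obj C" for a
    using on_mor_to_fractions[OF u[OF that]] by (simp add: \<alpha>_def)
  \<comment> \<open>Both sides are lifts of \<open>on_mor F f\<close>, so uniqueness of lifts
    applies.\<close>
  have nat: "u b \<cdot>\<^bsub>C\<^esub> f = l (on_mor F f) \<cdot>\<^bsub>C\<^esub> u a" if f: "f \<in> Hom C a b" for f a b
  proof -
    note obj = C.Hom_obj[OF f] and lf = l_hom[OF Fm[OF f]]
    note Fa = Fo[OF obj(1)] and Fb = Fo[OF obj(2)]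
    have "e (on_obj F b) \<cdot>\<^bsub>X\<^esub> on_mor F (u b \<cdot>\<^bsub>C\<^esub> f) = on_mor F f"
      using Fc[OF f u[OF obj(2)]] X.retraction_cancel[OF Fm[OF u[OF obj(2)]] e[OF Fb] eu[OF obj(2)] Fm[OF f]]
      by simp
    moreover have "e (on_obj F b) \<cdot>\<^bsub>X\<^esub> on_mor F (l (on_mor F f) \<cdot>\<^bsub>C\<^esub> u a) = on_mor F f"
      using Fc[OF u[OF obj(1)] lf] X.comp_assoc[OF Fm[OF u[OF obj(1)]] Fm[OF lf] e[OF Fb]]
        l_nat[OF Fm[OF f]] X.section_cancel[OF e[OF Fa] Fm[OF u[OF obj(1)]] eu[OF obj(1)] Fm[OF f]]
      by simp
    ultimately show ?thesis
      using lift_unique[OF Fb C.comp_hom[OF f u[OF obj(2)]] C.comp_hom[OF u[OF obj(1)] lf]] by simp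
  qed
  have "nat_trans (fractions C S) (fractions C S) id_func (comp_func L K) \<alpha>"
  proof (rule nat_trans_fractions[OF C.category_axioms is_functor_id[OF catF] is_functor_comp[OF K(1) L]])
    show "\<alpha> a \<in> Hom (fractions C S) (on_obj id_func a) (on_obj (comp_func L K) a)" if "a \<in> Obj C" for a
      using frac_hom[OF zigzag_Fwd[OF C.category_axioms u[OF that]]] that
      by (simp add: \<alpha>_def id_func_simps comp_func_simps Lo Ko)
    show "\<alpha> b \<cdot>\<^bsub>fractions C S\<^esub> on_mor id_func (frac C S a [Fwd f] b)
        = on_mor (comp_func L K) (frac C S a [Fwd f] b) \<cdot>\<^bsub>fractions C S\<^esub> \<alpha> a"
      if f: "f \<in> Hom C a b" for a b f
    proof -
      note obj = C.Hom_obj[OF f] and lf = l_hom[OF Fm[OF f]]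
      have "on_mor (comp_func L K) (frac C S a [Fwd f] b) = on_mor (to_fractions C S) (l (on_mor F f))"
        using Km[OF f] Lm[OF Fm[OF f]] on_mor_to_fractions[OF lf] by (simp add: comp_func_simps)
      then show ?thesis
        using functorD(4)[OF toF f u[OF obj(2)]] functorD(4)[OF toF u[OF obj(1)] lf] nat[OF f]
          \<alpha>[OF obj(1)] \<alpha>[OF obj(2)] on_mor_to_fractions[OF f, of S]
        by (simp add: id_func_simps)
    qed
  qed
  moreover have "is_iso (fractions C S) (\<alpha> a)" if "a \<in> Obj C" for a
    using to_fractions_inverts[OF C.category_axioms uS[OF that]] uS[OF that] S \<alpha>[OF that] by simp
  ultimately have "nat_iso (fractions C S) (fractions C S) id_func (comp_func L K) \<alpha>"
    by (simp add: nat_iso_def fractions_simps)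
  then show ?thesis
    unfolding equivalent_categories_def using K(1) L counit by blast
qed

section \<open>Duality for equivalences and categories of fractions\<close>

lemma nat_iso_opp: "nat_iso A B P Q \<tau> \<Longrightarrow> nat_iso (opp A) (opp B) Q P \<tau>"
  using is_functor_opp[of A B P] is_functor_opp[of A B Q]
  by (simp add: nat_iso_def nat_trans_def Hom_opp is_iso_opp opp_func_eq)

text \<open>Components reverse in the opposite category, so the unit takes the form required of a
  counit and conversely; this is why the two categories trade places.\<close>

lemma equivalent_categories_opp:
  assumes "equivalent_categories A B"
  shows "equivalent_categories (opp B) (opp A)"
proof -
  obtain K L \<alpha> \<beta> where K: "is_functor A B K" and L: "is_functor B A L"
    and "nat_iso A A id_func (comp_func L K) \<alpha>" "nat_iso B B (comp_func K L) id_func \<beta>"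
    using assms unfolding equivalent_categories_def by blast
  from this(3,4)[THEN nat_iso_opp] show ?thesis
    unfolding equivalent_categories_def
    using is_functor_opp[OF K] is_functor_opp[OF L] unfolding opp_func_eq by blast
qed

lemma func_eq_opp: "func_eq (opp A) P Q \<longleftrightarrow> func_eq A P Q"
  by (simp add: func_eq_def)

text \<open>Read as a functor from \<open>C\<close> into the opposite of
  \<open>fractions (opp C) S\<close>, the canonical functor still inverts \<open>S\<close>,
  isomorphisms being self-dual; the universal property extends it.\<close>

lemma fractions_opp_comparison:
  assumes C: "category C"
  shows "\<exists>\<Phi>. is_functor (opp (fractions C S)) (fractions (opp C) S) \<Phi> \<and>
    func_eq C (comp_func \<Phi> (to_fractions C S)) (to_fractions (opp C) S)"
proof -
  note Co = category_opp[OF C]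
  have "is_functor C (opp (fractions (opp C) S)) (to_fractions (opp C) S)"
    using is_functor_opp[OF is_functor_to_fractions[OF Co, of S]] by (simp add: opp_opp opp_func_eq)
  moreover have "is_iso (opp (fractions (opp C) S)) (on_mor (to_fractions (opp C) S) s)"
    if "s \<in> S" "s \<in> Mor C" for s
    using to_fractions_inverts[OF Co that(1)] that(2) by (simp add: is_iso_opp)
  ultimately obtain U where "is_functor (fractions C S) (opp (fractions (opp C) S)) U"
    "func_eq C (comp_func U (to_fractions C S)) (to_fractions (opp C) S)"
    using fractions_universal[of C _ _ S] by blast
  then show ?thesis using is_functor_opp opp_opp opp_func_eq by metis
qed

text \<open>\<open>U\<close> and the identity both extend the canonical functor.\<close>

lemma fractions_endofunctor_unique:
  assumes C: "category C" and U: "is_functor (fractions C S) (fractions C S) U"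
    and "func_eq C (comp_func U (to_fractions C S)) (to_fractions C S)"
  shows "func_eq (fractions C S) U id_func"
proof (rule fractions_universal_unique[OF is_functor_to_fractions[OF C] _ U assms(3)])
  show "is_functor (fractions C S) (fractions C S) id_func"
    by (rule is_functor_id[OF category_fractions[OF C]])
  show "func_eq C (comp_func id_func (to_fractions C S)) (to_fractions C S)"
    by (simp add: func_eq_def comp_func_simps id_func_simps)
qed (rule to_fractions_inverts[OF C])

text \<open>The comparison functors for \<open>C\<close> and \<open>opp C\<close> are mutually
  inverse, since their composites extend the canonical functors and hence are identities.\<close>

lemma fractions_opp_iso:
  assumes C: "category C"
  shows "\<exists>\<Phi>. iso_of_categories (opp (fractions C S)) (fractions (opp C) S) \<Phi> \<and>
    func_eq (opp C) (comp_func \<Phi> (opp_func (to_fractions C S))) (to_fractions (opp C) S)"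
proof -
  note Co = category_opp[OF C]
  obtain \<Phi> where \<Phi>: "is_functor (opp (fractions C S)) (fractions (opp C) S) \<Phi>"
    "func_eq C (comp_func \<Phi> (to_fractions C S)) (to_fractions (opp C) S)"
    using fractions_opp_comparison[OF C] by blast
  obtain \<Psi> where \<Psi>: "is_functor (opp (fractions (opp C) S)) (fractions C S) \<Psi>"
    "func_eq C (comp_func \<Psi> (to_fractions (opp C) S)) (to_fractions C S)"
    using fractions_opp_comparison[OF Co, of S] by (auto simp: opp_opp func_eq_opp)
  have \<Psi>': "is_functor (fractions (opp C) S) (opp (fractions C S)) \<Psi>"
    and \<Phi>': "is_functor (fractions C S) (opp (fractions (opp C) S)) \<Phi>"
    using is_functor_opp[OF \<Psi>(1)] is_functor_opp[OF \<Phi>(1)] by (simp_all add: opp_opp opp_func_eq)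
  have "func_eq (fractions C S) (comp_func \<Psi> \<Phi>) id_func"
    by (rule fractions_endofunctor_unique[OF C is_functor_comp[OF \<Phi>' \<Psi>(1)]])
      (use \<Phi>(2) \<Psi>(2) in \<open>simp add: func_eq_def comp_func_simps\<close>)
  moreover have "func_eq (fractions (opp C) S) (comp_func \<Phi> \<Psi>) id_func"
    by (rule fractions_endofunctor_unique[OF Co is_functor_comp[OF \<Psi>' \<Phi>(1)]])
      (use \<Phi>(2) \<Psi>(2) in \<open>simp add: func_eq_def comp_func_simps\<close>)
  ultimately have "iso_of_categories (opp (fractions C S)) (fractions (opp C) S) \<Phi>"
    unfolding iso_of_categories_def func_eq_opp using \<Phi>(1) \<Psi>' by blast
  then show ?thesis using \<Phi>(2) by (auto simp: func_eq_opp opp_func_eq)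
qed

section \<open>Coincidence of the classes and the spectral categories\<close>

theorem theorem6p6:
  fixes C :: "('o, 'm) cat" and X :: "('p, 'n) cat"
    and F :: "('o, 'm, 'p, 'n) func" and G :: "('p, 'n, 'o, 'm) func"
    and \<eta> :: "'o \<Rightarrow> 'm" and \<epsilon> :: "'p \<Rightarrow> 'n"
  assumes "category C" and "has_finite_limits C" and "has_finite_colimits C"
    and "category X" and "has_finite_limits X" and "has_finite_colimits X"
    and "essential_localization C X F G \<eta> \<epsilon>" and "faithful C F"
    and i: "\<And>m. pullback_stable_essential_mono X m \<Longrightarrow> is_iso X m"
    and ii: "\<And>m. pullback_stable_essential_mono (opp X) m \<Longrightarrow> is_iso (opp X) m"
    and iii: "balanced X"
  shows "{m. pullback_stable_essential_mono C m} = {m. pullback_stable_essential_mono (opp C) m} \<and>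
         {m. pullback_stable_essential_mono C m} = {m. bimorphism C m} \<and>
         (\<exists>\<Phi>. iso_of_categories (opp (Spec C)) (Spec (opp C)) \<Phi> \<and>
            func_eq (opp C) (comp_func \<Phi> (opp_func (to_Spec C))) (to_Spec (opp C))) \<and>
         equivalent_categories (Spec C) X \<and>
         equivalent_categories X (opp (Spec (opp C)))"
proof -
  interpret D: faithful_bilift C X F by (rule essential_localization_bilift) fact+
  interpret E: faithful_bilift "opp C" "opp X" F by (rule D.dual)
  have pb: "has_pullbacks C" using D.C.has_pullbacksI assms(2) .
  have pbo: "has_pullbacks (opp C)"
    using E.C.has_pullbacksI assms(3) unfolding has_finite_colimits_def .
  have S: "pullback_stable_essential_mono C m \<longleftrightarrow> m \<in> Mor C \<and> is_iso X (on_mor F m)" for m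
    by (rule D.pullback_stable_iff[OF pb i])
  \<comment> \<open>Hypothesis (ii) plays for the opposite functor the role of (i), and inverting a
    morphism means the same in \<open>X\<close> and \<open>opp X\<close>.\<close>
  have So: "pullback_stable_essential_mono (opp C) m \<longleftrightarrow> m \<in> Mor C \<and> is_iso X (on_mor F m)" for m
    using E.pullback_stable_iff[OF pbo ii] by (simp add: is_iso_opp)
  have eq: "{m. pullback_stable_essential_mono (opp C) m} = {m. pullback_stable_essential_mono C m}"
    by (simp add: S So)
  have "equivalent_categories (Spec C) X"
    unfolding Spec_def by (rule fractions_equivalent[OF D.F D.faithful D.right_lifts]) (simp add: S)
  \<comment> \<open>In the opposite categories the left lifts of \<open>F\<close> serve as right
    lifts; dualizing the resulting equivalence gives the one claimed.\<close>
  moreover have "equivalent_categories (Spec (opp C)) (opp X)"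
    unfolding Spec_def
    by (rule fractions_equivalent[OF E.F E.faithful E.right_lifts]) (simp add: So is_iso_opp)
  from equivalent_categories_opp[OF this] have "equivalent_categories X (opp (Spec (opp C)))"
    by (simp add: opp_opp)
  \<comment> \<open>By \<open>eq\<close> both spectral categories invert the same class, so the
    comparison for a fixed class applies.\<close>
  moreover have "\<exists>\<Phi>. iso_of_categories (opp (Spec C)) (Spec (opp C)) \<Phi> \<and>
      func_eq (opp C) (comp_func \<Phi> (opp_func (to_Spec C))) (to_Spec (opp C))"
    unfolding Spec_def to_Spec_def eq by (rule fractions_opp_iso[OF D.C.category_axioms])
  moreover have "{m. pullback_stable_essential_mono C m} = {m. bimorphism C m}"
    by (simp add: S D.bimorphism_iff[OF iii])
  ultimately show ?thesis using eq by simp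
qed

end
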